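(* Let $d$ be either $0$ or a positive square-free integer, $K=\mathbb{Q}(\sqrt{-d})$, $R$ the ring of integers of $K$. Then the induced subgraph $\Gamma_{S_{tc}(R)}(M_2(R))$ of $\Gamma(M_2(R))$ on the vertex set $S_{tc}(R)$ decomposes into connected components as follows. (Case 1) If $d\neq 1,3$: (1) a component $\Gamma_1$ with vertex set $S_{tc,1,0}(R)\cup S_{tc,2}(R)$, which is an (undirected) infinite complete bipartite graph with girth $g(\Gamma_1)=4$; (2) a component $\Gamma_2$ with vertex set $S_{tc,1,-1}(R)\cup S_{tc,1,1}(R)$, which is a directed infinite graph whose underlying undirected graph $\Gamma_2^{un}$ has girth $3$; (3) all remaining vertices, namely those in $S_{tc,1,t}(R)$ with $t\in R$, $t\neq 0,\pm1$, are isolated vertices (components $K_1$). (Case 2) If $d=1$ (with $i=\sqrt{-1}$): (1) a component $\Gamma_1$ with vertex set $S_{tc,1,0}(R)\cup S_{tc,2}(R)$, an (undirected) infinite complete bipartite graph with $g(\Gamma_1)=4$; (2) a component $\Gamma_2$ with vertex set $S_{tc,1,-1}(R)\cup S_{tc,1,1}(R)\cup S_{tc,1,i}(R)\cup S_{tc,1,-i}(R)$, a directed infinite graph with $g(\Gamma_2^{un})=3$; (3) all vertices in $S_{tc,1,t}(R)$ with $t\neq 0,\pm1,\pm i$ are isolated vertices. (Case 3) If $d=3$ (with $\omega$ a primitive third root of unity): (1) a component $\Gamma_1$ with vertex set $S_{tc,1,0}(R)\cup S_{tc,2}(R)$, an (undirected) infinite complete bipartite graph with $g(\Gamma_1)=4$;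 (2) a component $\Gamma_2$ with vertex set $S_{tc,1,-1}(R)\cup S_{tc,1,1}(R)$, a directed infinite graph with $g(\Gamma_2^{un})=3$; (3) a component $\Gamma_3$ with vertex set $S_{tc,1,\omega}(R)\cup S_{tc,1,-\omega}(R)$, a directed infinite graph with $g(\Gamma_3^{un})=3$; (4) a component $\Gamma_4$ with vertex set $S_{tc,1,\omega^2}(R)\cup S_{tc,1,-\omega^2}(R)$, a directed infinite graph with $g(\Gamma_4^{un})=3$; (5) all vertices in $S_{tc,1,t}(R)$ with $t\neq 0,\pm1,\pm\omega,\pm\omega^2$ are isolated vertices.
   Context: For a ring $S$ with identity, $Z(S)$ is the set of all (left or right) zero-divisors and $Z(S)^\times=Z(S)\setminus\{0\}$. The zero-divisor graph $\Gamma(S)$ is the directed graph with vertex set $Z(S)^\times$ and an edge $v_1\to v_2$ between distinct vertices iff $v_1v_2=0$; its underlying undirected graph has $v_1,v_2$ adjacent iff $v_1v_2=0$ or $v_2v_1=0$. For a subset $T\subseteq Z(S)^\times$, $\Gamma_T(S)$ is the induced subgraph on $T$. For $t\in R$ define $S_{tc,1,t}(R)=\{\lambda\begin{bmatrix}1&t\\t^2&t^3\end{bmatrix}:\lambda\in R\setminus\{0\}\}$, $S_{tc,1}(R)=\bigcup_{t\in R}S_{tc,1,t}(R)$, $S_{tc,2}(R)=\{\begin{bmatrix}0&0\\0&\lambda\end{bmatrix}:\lambda\in R\setminus\{0\}\}$, and $S_{tc}(R)=S_{tc,1}(R)\cup S_{tc,2}(R)\subseteq Z(M_2(R))^\times$.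 Girth $g$ is the length of a shortest cycle; for a directed graph $\Gamma$, $\Gamma^{un}$ is its underlying undirected graph. When $d=0$, $R=\mathbb{Z}$. *)

theory Defs
  imports "HOL-Analysis.Analysis" "HOL-Algebra.Algebra"
    "HOL-Algebra.Algebraic_Closure_Type" "Graph_Theory.Graph_Theory"
begin

text \<open>The subfield of the complex numbers generated by the square root of \<open>-d\<close>;
  for \<open>d = 0\<close> it is the prime field, i.e. the rationals.\<close>

definition imag_quadratic_field :: "nat \<Rightarrow> complex set" where
  "imag_quadratic_field d = generate_field ring_of_type_algebra {csqrt (- of_nat d)}"

definition ring_of_integers :: "complex set \<Rightarrow> complex set" where
  "ring_of_integers K = {x \<in> K. algebraic_int x}"

definition M2 :: "complex set \<Rightarrow> (complex^2^2) ring" where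
  "M2 R = \<lparr>carrier = {A. \<forall>i j. A $ i $ j \<in> R}, mult = (**), one = mat 1, ring.zero = 0, add = (+)\<rparr>"

definition zero_divisors :: "('a, 'b) ring_scheme \<Rightarrow> 'a set" where
  "zero_divisors S = {a \<in> carrier S. \<exists>b \<in> carrier S - {\<zero>\<^bsub>S\<^esub>}.
     a \<otimes>\<^bsub>S\<^esub> b = \<zero>\<^bsub>S\<^esub> \<or> b \<otimes>\<^bsub>S\<^esub> a = \<zero>\<^bsub>S\<^esub>}"

definition zero_divisor_graph :: "('a, 'b) ring_scheme \<Rightarrow> 'a pair_pre_digraph" where
  "zero_divisor_graph S = \<lparr>pverts = zero_divisors S - {\<zero>\<^bsub>S\<^esub>},
     parcs = {(v, w). v \<in> zero_divisors S - {\<zero>\<^bsub>S\<^esub>} \<and> w \<in> zero_divisors S - {\<zero>\<^bsub>S\<^esub>} \<and>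
       v \<noteq> w \<and> v \<otimes>\<^bsub>S\<^esub> w = \<zero>\<^bsub>S\<^esub>}\<rparr>"

definition Stc1t :: "complex set \<Rightarrow> complex \<Rightarrow> (complex^2^2) set" where
  "Stc1t R t = {map_matrix ((*) c) (vector [vector [1, t], vector [t^2, t^3]]) | c. c \<in> R - {0}}"

definition Stc1 :: "complex set \<Rightarrow> (complex^2^2) set" where
  "Stc1 R = (\<Union>t\<in>R. Stc1t R t)"

definition Stc2 :: "complex set \<Rightarrow> (complex^2^2) set" where
  "Stc2 R = {vector [vector [0, 0], vector [0, c]] | c. c \<in> R - {0}}"

definition Stc :: "complex set \<Rightarrow> (complex^2^2) set" where
  "Stc R = Stc1 R \<union> Stc2 R"

text \<open>Connected components of a digraph are those of its underlying undirected graph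
  (\<^const>\<open>Digraph_Component.connected\<close> is weak connectivity), taken as induced subgraphs;
  compare \<^const>\<open>pre_digraph.sccs\<close>.\<close>

definition digraph_components :: "('a, 'b) pre_digraph \<Rightarrow> ('a, 'b) pre_digraph set" where
  "digraph_components G = {H. induced_subgraph H G \<and> Digraph_Component.connected H \<and>
     \<not> (\<exists>H'. induced_subgraph H' G \<and> Digraph_Component.connected H' \<and> verts H \<subset> verts H')}"

text \<open>Undirected graphs are represented as symmetric digraphs.  There \<^const>\<open>pre_digraph.cycle\<close>
  also admits an edge traversed back and forth, which is not a cycle of the undirected graph;
  hence the lower bound on the length.\<close>

definition girth :: "('a, 'b) pre_digraph \<Rightarrow> enat" where
  "girth G = (INF p \<in> {p. pre_digraph.cycle G p \<and> 3 \<le> length p}. enat (length p))"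

text \<open>As \<^const>\<open>complete_bipartite_digraph\<close>, but with parts of arbitrary cardinality; the arc set
  is symmetric, so this is a property of undirected graphs.\<close>

definition complete_bipartite :: "('a, 'b) pre_digraph \<Rightarrow> bool" where
  "complete_bipartite G \<longleftrightarrow> (\<exists>U V. U \<noteq> {} \<and> V \<noteq> {} \<and> U \<inter> V = {} \<and> verts G = U \<union> V \<and>
     arcs_ends G = U \<times> V \<union> V \<times> U)"

end

theory Submission
  imports Defs
begin

text \<open>The matrix with parameters \<open>c\<close>, \<open>t\<close> is the rank-one product \<open>c (1, t\<^sup>2)\<^sup>T (1, t)\<close>, so the product
  of the matrices with parameters \<open>t\<close> and \<open>s\<close> is a multiple of \<open>1 + t s\<^sup>2\<close>: there is an arc exactly
  when \<open>t s\<^sup>2 = - 1\<close>, and then \<open>s\<close> is a unit of \<open>R\<close>.  A unit of \<open>R\<close> has norm 1 and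
  integral trace in \<open>[-2, 2]\<close>, which leaves \<open>\<plusminus>1\<close>, for \<open>d = 1\<close> also \<open>\<plusminus>\<i>\<close>, and for \<open>d = 3\<close> also
  \<open>\<plusminus>\<omega>\<close>, \<open>\<plusminus>\<omega>\<^sup>2\<close>; solving \<open>t = - s\<^sup>-\<^sup>2\<close> for these gives all the arcs.  The matrices of
  \<open>S\<^sub>t\<^sub>c\<^sub>,\<^sub>2\<close> annihilate exactly those with \<open>t = 0\<close>, on both sides.\<close>

section \<open>Integers of imaginary quadratic fields\<close>

lemma inv_ring_of_type_algebra:
  fixes h :: "'a :: Fields.field"
  assumes "h \<noteq> 0"
  shows "inv\<^bsub>ring_of_type_algebra\<^esub> h = inverse h"
proof -
  interpret field "ring_of_type_algebra :: 'a ring"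
    by (rule field_from_type_algebra)
  show ?thesis
    using assms by (intro comm_inv_char) (auto simp: ring_of_type_algebra_def)
qed

lemma a_inv_ring_of_type_algebra: "\<ominus>\<^bsub>ring_of_type_algebra\<^esub> h = - (h :: 'a :: Fields.field)"
proof -
  interpret field "ring_of_type_algebra :: 'a ring"
    by (rule field_from_type_algebra)
  show ?thesis
    by (intro minus_equality) (auto simp: ring_of_type_algebra_def)
qed

lemma csqrt_neg_of_nat: "csqrt (- of_nat d) = \<i> * of_real (sqrt d)"
  using csqrt_of_real_nonpos[of "- real d"] by simp

lemma Rats_Re: "x \<in> \<rat> \<Longrightarrow> complex_of_real (Re x) = x"
  by (elim Rats_cases') (auto simp: complex_eq_iff)

lemma Re_of_rat: "Re (of_rat a) = of_rat a"
  by (cases a) (simp add: Fract_of_int_quotient of_rat_divide)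

lemma Im_of_rat: "Im (of_rat a) = 0"
  by (cases a) (simp add: Fract_of_int_quotient of_rat_divide)

text \<open>With \<open>s\<close> the square root of \<open>- d\<close>, the elements
  \<open>a + b * s\<close> are closed under the field operations: products reduce by
  \<open>s * s = - d\<close>, inverses come from the conjugate. Conversely, the generated field
  contains \<open>1\<close>, hence all rationals, and \<open>s\<close>. For \<open>d = 0\<close> the
  root is \<open>0\<close> and only the rationals remain.\<close>

lemma imag_quadratic_field_eq:
  "imag_quadratic_field d = {a + b * csqrt (- of_nat d) | a b. a \<in> \<rat> \<and> b \<in> \<rat>}"
    (is "?K = ?E")
proof -
  define s where "s = csqrt (- of_nat d)"
  have ss: "s * s = - of_nat d"
    using power2_csqrt[of "- of_nat d"] by (simp only: s_def power2_eq_square)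
  have K: "?K = generate_field ring_of_type_algebra {s}"
    by (simp add: imag_quadratic_field_def s_def)
  note simps = ring_of_type_algebra_def
  have one: "1 \<in> ?K"
    using generate_field.one[of ring_of_type_algebra "{s}"] by (simp add: K simps)
  have s: "s \<in> ?K"
    using generate_field.incl[of s "{s}" ring_of_type_algebra] by (simp add: K)
  have neg: "- x \<in> ?K" if "x \<in> ?K" for x
    using generate_field.a_inv[OF that[unfolded K]] by (simp add: K a_inv_ring_of_type_algebra)
  \<comment> \<open>The generating rule for inverses covers nonzero elements only; at
    \<open>0\<close> the convention \<open>inverse 0 = 0\<close> helps.\<close>
  have inv: "inverse x \<in> ?K" if "x \<in> ?K" for x
  proof (cases "x = 0")
    case False
    then show ?thesis
      using generate_field.m_inv[of x ring_of_type_algebra "{s}"] that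
      by (simp add: K inv_ring_of_type_algebra) (simp add: simps)
  qed (use that in simp)
  have add: "x + y \<in> ?K" if "x \<in> ?K" "y \<in> ?K" for x y
    using generate_field.eng_add[OF that[unfolded K]] by (simp add: K simps)
  have mult: "x * y \<in> ?K" if "x \<in> ?K" "y \<in> ?K" for x y
    using generate_field.eng_mult[OF that[unfolded K]] by (simp add: K simps)
  \<comment> \<open>The base case \<open>0\<close> is obtained as \<open>1 + (- 1)\<close>.\<close>
  have nat: "of_nat n \<in> ?K" for n
    by (induction n) (use add[OF one neg[OF one]] add one in auto)
  have int: "of_int n \<in> ?K" for n
    by (cases n) (use nat neg nat[of "Suc _"] in \<open>auto simp del: of_nat_Suc\<close>)
  have rat: "x \<in> ?K" if "x \<in> \<rat>" for x
    using that by (elim Rats_cases') (auto simp: divide_inverse intro!: mult int inv)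
  have "?E \<subseteq> ?K"
    using add mult rat s by (auto simp: s_def)
  moreover have "x \<in> ?E" if "x \<in> generate_field ring_of_type_algebra {s}" for x
    using that
  proof induction
    case one
    show ?case by (intro CollectI exI[of _ 1] exI[of _ 0]) (auto simp: simps)
  next
    case (incl h)
    then show ?case by (intro CollectI exI[of _ 0] exI[of _ 1]) (auto simp: s_def)
  next
    case (a_inv h)
    then obtain a b where "a \<in> \<rat>" "b \<in> \<rat>" "h = a + b * s"
      by (auto simp: s_def)
    then show ?case
      by (intro CollectI exI[of _ "-a"] exI[of _ "-b"])
        (auto simp: a_inv_ring_of_type_algebra s_def)
  next
    case (m_inv h)
    then obtain a b where ab: "a \<in> \<rat>" "b \<in> \<rat>" "h = a + b * s"
      by (auto simp: s_def)
    have h: "h \<noteq> 0"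
      using m_inv by (simp add: simps)
    \<comment> \<open>\<open>N\<close> is the norm of \<open>h\<close>. The cofactor
      \<open>a - b * s\<close> is \<open>cnj h\<close>, so \<open>N\<close> is nonzero and the
      cofactor divided by \<open>N\<close> is the inverse.\<close>
    define N where "N = a ^ 2 + of_nat d * b ^ 2"
    have N: "h * (a - b * s) = N"
      using ss by (simp add: ab N_def algebra_simps power2_eq_square)
    have "a - b * s = cnj h"
    proof -
      have "cnj a = a" "cnj b = b" "cnj s = - s"
        using Rats_Re[OF ab(1)] Rats_Re[OF ab(2)]
        by (metis complex_cnj_complex_of_real)+ (simp add: s_def csqrt_neg_of_nat)
      then show ?thesis by (simp add: ab)
    qed
    then have "N \<noteq> 0"
      using N h by auto
    then have "inverse h = a / N + (- b / N) * s"
      using N h by (simp add: field_simps)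
    moreover have "N \<in> \<rat>"
      using ab by (simp add: N_def)
    ultimately show ?case
      using ab h
      by (intro CollectI exI[of _ "a / N"] exI[of _ "- b / N"])
        (auto simp: inv_ring_of_type_algebra s_def)
  next
    case (eng_add h1 h2)
    then obtain a b a' b' where "a \<in> \<rat>" "b \<in> \<rat>" "h1 = a + b * s" "a' \<in> \<rat>" "b' \<in> \<rat>" "h2 = a' + b' * s"
      by (auto simp: s_def)
    then show ?case
      by (intro CollectI exI[of _ "a + a'"] exI[of _ "b + b'"])
        (auto simp: simps s_def algebra_simps)
  next
    case (eng_mult h1 h2)
    then obtain a b a' b' where *: "a \<in> \<rat>" "b \<in> \<rat>" "h1 = a + b * s" "a' \<in> \<rat>" "b' \<in> \<rat>" "h2 = a' + b' * s"
      by (auto simp: s_def)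
    have "h1 * h2 = (a * a' + b * b' * (s * s)) + (a * b' + a' * b) * s"
      unfolding * by (simp add: algebra_simps)
    then show ?case
      using * unfolding ss
      by (intro CollectI exI[of _ "a * a' + b * b' * - of_nat d"] exI[of _ "a * b' + a' * b"])
        (auto simp: simps s_def)
  qed
  ultimately show ?thesis
    unfolding K by blast
qed

section \<open>Algebraic integers through trace and norm\<close>

text \<open>The monic quadratic with roots \<open>x\<close> and \<open>cnj x\<close> has the norm
  and minus the trace as its lower coefficients.\<close>

lemma algebraic_int_of_trace_norm:
  fixes x :: complex
  assumes "x + cnj x \<in> \<int>" "x * cnj x \<in> \<int>"
  shows "algebraic_int x"
proof
  let ?p = "[:x * cnj x, - (x + cnj x), 1:]"
  show "Polynomial.lead_coeff ?p = 1" by simp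
  show "\<forall>i. poly.coeff ?p i \<in> \<int>"
    using assms by (auto simp: coeff_pCons split: nat.splits simp del: minus_add_distrib)
  show "poly ?p x = 0"
    by (simp add: algebra_simps)
qed

lemma map_poly_of_int_add:
  "map_poly of_int (p + q) = map_poly of_int p + (map_poly of_int q :: 'a :: comm_ring_1 poly)"
  by (intro poly_eqI) (simp add: coeff_map_poly)

lemma map_poly_of_int_mult:
  "map_poly of_int (p * q) = map_poly of_int p * (map_poly of_int q :: 'a :: comm_ring_1 poly)"
  by (intro poly_eqI) (simp add: coeff_map_poly coeff_mult)

lemma map_poly_of_int_smult:
  "map_poly of_int (Polynomial.smult c p) = Polynomial.smult (of_int c) (map_poly of_int p :: 'a :: comm_ring_1 poly)"
  by (intro poly_eqI) (simp add: coeff_map_poly)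

text \<open>By Gauss' lemma the primitive integral multiple of the minimal polynomial of \<open>x\<close> divides a monic
  integer polynomial, so its leading coefficient is a unit.\<close>

lemma trace_norm_of_algebraic_int:
  fixes x :: complex
  assumes x: "algebraic_int x" "Im x \<noteq> 0"
    and rat: "x + cnj x \<in> \<rat>" "x * cnj x \<in> \<rat>"
  shows "x + cnj x \<in> \<int>" "x * cnj x \<in> \<int>"
proof -
  obtain p :: "int poly" where p: "poly (map_poly of_int p) x = 0" "Polynomial.lead_coeff p = 1"
    using x(1) by (auto simp: algebraic_int_altdef_ipoly)
  obtain a1 b1 where 1: "b1 > 0" "x + cnj x = of_int a1 / of_int b1"
    using rat(1) by (auto elim!: Rats_cases')
  obtain a2 b2 where 2: "b2 > 0" "x * cnj x = of_int a2 / of_int b2"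
    using rat(2) by (auto elim!: Rats_cases')
  \<comment> \<open>This is \<open>(X - x) * (X - cnj x)\<close> with denominators cleared by the
    factor \<open>b1 * b2\<close>.\<close>
  define q0 :: "int poly" where "q0 = [:a2 * b1, - a1 * b2, b1 * b2:]"
  define q where "q = primitive_part q0"
  have q0: "q0 = Polynomial.smult (content q0) q"
    by (simp add: q_def)
  have "q0 \<noteq> 0" "Polynomial.degree q0 = 2"
    using 1 2 by (auto simp: q0_def)
  then have c0: "content q0 \<noteq> 0" and q_nz: "q \<noteq> 0" and deg_q: "Polynomial.degree q = 2"
    and cq: "content q = 1"
    by (auto simp: q_def)
  \<comment> \<open>Dividing by the content keeps the coefficients in the proportion of norm, minus
    trace, and 1.\<close>
  have rel: "of_int (poly.coeff q 0) = of_int (poly.coeff q 2) * (x * cnj x)"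
    "of_int (poly.coeff q 1) = - of_int (poly.coeff q 2) * (x + cnj x)"
  proof -
    have c: "of_int (poly.coeff q0 i) = of_int (content q0) * (of_int (poly.coeff q i) :: complex)" for i
      by (subst q0) simp
    have "of_int (poly.coeff q0 0) = of_int (poly.coeff q0 2) * (x * cnj x)"
      "of_int (poly.coeff q0 1) = - of_int (poly.coeff q0 2) * (x + cnj x)"
      unfolding 1(2) 2(2) using 1(1) 2(1) by (simp_all add: q0_def numeral_2_eq_2)
    then have "of_int (content q0) * of_int (poly.coeff q 0) = of_int (content q0) * (of_int (poly.coeff q 2) * (x * cnj x))"
      "of_int (content q0) * of_int (poly.coeff q 1) = of_int (content q0) * (- of_int (poly.coeff q 2) * (x + cnj x))"
      unfolding c by (simp_all only: mult.assoc mult_minus_left mult_minus_right)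
    moreover have "complex_of_int (content q0) \<noteq> 0"
      using c0 by simp
    ultimately show "of_int (poly.coeff q 0) = of_int (poly.coeff q 2) * (x * cnj x)"
      "of_int (poly.coeff q 1) = - of_int (poly.coeff q 2) * (x + cnj x)"
      by (metis mult_left_cancel)+
  qed
  have "q = [:poly.coeff q 0, poly.coeff q 1, poly.coeff q 2:]"
    using deg_q by (intro poly_eqI) (auto simp: coeff_pCons numeral_2_eq_2 coeff_eq_0 split: nat.splits)
  then have "map_poly of_int q = [:of_int (poly.coeff q 0), of_int (poly.coeff q 1), of_int (poly.coeff q 2) :: complex:]"
    by (metis map_poly_pCons map_poly_0 of_int_0)
  then have qx: "poly (map_poly of_int q) x = 0"
    using rel(1) by (simp add: rel(2)[unfolded One_nat_def] algebra_simps)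
  \<comment> \<open>Over the integers, division by \<open>q\<close> works only after scaling
    \<open>p\<close> by some \<open>k\<close>, which is cancelled again below.\<close>
  obtain k u where k: "k \<noteq> 0" "Polynomial.smult k p = q * u + pseudo_mod p q"
    using pseudo_mod(1)[OF q_nz] by blast
  define r where "r = pseudo_mod p q"
  have "Polynomial.degree r < 2"
    using pseudo_mod(2)[OF q_nz, of p] deg_q by (auto simp: r_def)
  then have r: "r = [:poly.coeff r 0, poly.coeff r 1:]"
    by (intro poly_eqI) (auto simp: coeff_pCons coeff_eq_0 split: nat.splits)
  have "poly (map_poly of_int (Polynomial.smult k p)) x = poly (map_poly of_int (q * u + r)) x"
    using k by (simp add: r_def)
  then have "poly (map_poly of_int r) x = 0"
    using p(1) qx by (simp add: map_poly_of_int_add map_poly_of_int_mult map_poly_of_int_smult)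
  then have "of_int (poly.coeff r 0) + of_int (poly.coeff r 1) * x = 0"
    by (subst (asm) r) (simp add: map_poly_pCons mult.commute)
  \<comment> \<open>A polynomial of degree below 2 with integer coefficients and a nonreal root is
    zero; compare imaginary parts first.\<close>
  then have "poly.coeff r 1 = 0" "poly.coeff r 0 = 0"
    using x(2) by (auto simp: complex_eq_iff)
  then have "r = 0"
    by (subst r) simp
  then have eq: "Polynomial.smult k p = q * u"
    using k by (simp add: r_def)
  \<comment> \<open>Gauss' lemma: contents multiply and \<open>q\<close> is primitive, so
    \<open>k\<close> divides every coefficient of \<open>u\<close> and cancels.\<close>
  have "content u = \<bar>k\<bar> * content p"
    using arg_cong[OF eq, of content] cq by (simp add: content_mult)
  then have "[:k:] dvd u"
    by (metis abs_dvd_iff const_poly_dvd_iff content_dvd_coeff dvd_triv_left dvd_trans)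
  then obtain u' where u': "u = [:k:] * u'"
    by (auto simp: dvd_def)
  have "[:k:] * p = [:k:] * (q * u')"
    using eq by (simp add: u')
  then have "p = q * u'"
    using k(1) by (metis mult_left_cancel pCons_eq_0_iff)
  \<comment> \<open>As \<open>p\<close> is monic, \<open>q\<close> has leading coefficient 1 or -1,
    and \<open>rel\<close> yields trace and norm as integers up to sign.\<close>
  then have "Polynomial.lead_coeff q dvd 1"
    using lead_coeff_mult[of q u'] p(2) by (metis dvd_triv_left)
  then have "poly.coeff q 2 = 1 \<or> poly.coeff q 2 = -1"
    using deg_q by auto
  moreover have "\<exists>m. of_int m * z \<in> \<int> \<and> (m = 1 \<or> m = -1) \<Longrightarrow> z \<in> \<int>" for z :: complex
    by auto
  moreover have "of_int (poly.coeff q 2) * (x + cnj x) \<in> \<int>" "of_int (poly.coeff q 2) * (x * cnj x) \<in> \<int>"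
    using rel by (metis Ints_of_int Ints_minus minus_minus mult_minus_left)+
  ultimately show "x + cnj x \<in> \<int>" "x * cnj x \<in> \<int>"
    by blast+
qed

lemma imag_quadratic_field_conj:
  assumes "x \<in> imag_quadratic_field d"
  shows "cnj x \<in> imag_quadratic_field d" "x + cnj x \<in> \<rat>" "x * cnj x \<in> \<rat>"
    "Im x = 0 \<Longrightarrow> x \<in> \<rat>"
proof -
  obtain a b where ab: "a \<in> \<rat>" "b \<in> \<rat>" "x = a + b * csqrt (- of_nat d)"
    using assms by (auto simp: imag_quadratic_field_eq)
  have cnj: "cnj a = a" "cnj b = b" "cnj (csqrt (- of_nat d)) = - csqrt (- of_nat d)"
    using Rats_Re[OF ab(1)] Rats_Re[OF ab(2)]
    by (metis complex_cnj_complex_of_real)+ (simp add: csqrt_neg_of_nat)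
  have cx: "cnj x = a + (- b) * csqrt (- of_nat d)"
    by (simp add: ab(3) cnj)
  show "cnj x \<in> imag_quadratic_field d"
    unfolding imag_quadratic_field_eq cx using ab Rats_minus_iff by blast
  have "x + cnj x = 2 * a"
    unfolding cx by (subst ab(3)) simp
  moreover have "2 * a \<in> \<rat>"
    using ab(1) by simp
  ultimately show "x + cnj x \<in> \<rat>"
    by (simp only:)
  have "x * cnj x = a ^ 2 - b ^ 2 * csqrt (- of_nat d) ^ 2"
    unfolding cx by (subst ab(3)) (simp add: algebra_simps power2_eq_square)
  also have "\<dots> \<in> \<rat>"
    unfolding power2_csqrt using ab(1,2) by simp
  finally show "x * cnj x \<in> \<rat>" .
  assume "Im x = 0"
  moreover have "Im x = Re b * sqrt d"
    using ab Im_of_rat Re_of_rat unfolding ab(3) csqrt_neg_of_nat by (auto elim!: Rats_cases)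
  \<comment> \<open>In either case the term with the root vanishes, which leaves
    \<open>x = a\<close>.\<close>
  ultimately have "b = 0 \<or> d = 0"
    using Rats_Re[OF ab(2)] by (metis mult_eq_0_iff of_nat_eq_0_iff of_real_0 real_sqrt_eq_zero_cancel_iff)
  then show "x \<in> \<rat>"
    using ab by auto
qed

text \<open>A real element of the field is rational, so integrality makes it an ordinary integer;
  for a nonreal one, \<open>trace_norm_of_algebraic_int\<close> applies. This turns integrality into
  two conditions that are easy to compute with.\<close>

lemma ring_of_integers_iff:
  "x \<in> ring_of_integers (imag_quadratic_field d) \<longleftrightarrow>
    x \<in> imag_quadratic_field d \<and> x + cnj x \<in> \<int> \<and> x * cnj x \<in> \<int>"
proof
  assume "x \<in> ring_of_integers (imag_quadratic_field d)"
  then have x: "x \<in> imag_quadratic_field d" "algebraic_int x"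
    by (auto simp: ring_of_integers_def)
  note conj = imag_quadratic_field_conj[OF x(1)]
  show "x \<in> imag_quadratic_field d \<and> x + cnj x \<in> \<int> \<and> x * cnj x \<in> \<int>"
  proof (cases "Im x = 0")
    case True
    then have "x \<in> \<int>"
      using rational_algebraic_int_is_int x conj(4) by blast
    then show ?thesis
      using x by (auto elim!: Ints_cases)
  next
    case False
    then show ?thesis
      using x trace_norm_of_algebraic_int[OF x(2) _ conj(2,3)] by blast
  qed
qed (auto simp: ring_of_integers_def algebraic_int_of_trace_norm)

lemma imag_quadratic_field_mult:
  assumes "x \<in> imag_quadratic_field d" "y \<in> imag_quadratic_field d"
  shows "x * y \<in> imag_quadratic_field d"
  using generate_field.eng_mult[OF assms[unfolded imag_quadratic_field_def]]
  by (simp add: imag_quadratic_field_def ring_of_type_algebra_def)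

lemma Ints_subset_ring_of_integers: "\<int> \<subseteq> ring_of_integers (imag_quadratic_field d)"
proof
  fix x :: complex assume "x \<in> \<int>"
  then have "x = x + 0 * csqrt (- of_nat d)" "x \<in> \<rat>"
    using Ints_subset_Rats by auto
  then have "x \<in> imag_quadratic_field d"
    unfolding imag_quadratic_field_eq using Rats_0 by blast
  then show "x \<in> ring_of_integers (imag_quadratic_field d)"
    using \<open>x \<in> \<int>\<close> by (simp add: ring_of_integers_def int_imp_algebraic_int)
qed

text \<open>The traces of \<open>x y\<close> and of \<open>x (cnj y)\<close> have integral sum and product, so both are roots of
  a monic quadratic with integer coefficients; being rational, they are integers.\<close>

lemma ring_of_integers_mult:
  assumes x: "x \<in> ring_of_integers (imag_quadratic_field d)"
    and y: "y \<in> ring_of_integers (imag_quadratic_field d)"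
  shows "x * y \<in> ring_of_integers (imag_quadratic_field d)"
proof -
  note x' = x[unfolded ring_of_integers_iff] and y' = y[unfolded ring_of_integers_iff]
  have K: "x * y \<in> imag_quadratic_field d"
    using x' y' imag_quadratic_field_mult by blast
  define w where "w = x * y + cnj (x * y)"
  define v where "v = x * cnj y + cnj x * y"
  define p where "p = [:w * v, - (w + v), 1:]"
  have sq: "z ^ 2 + cnj z ^ 2 = (z + cnj z) ^ 2 - 2 * (z * cnj z)" for z
    by (simp add: power2_eq_square algebra_simps)
  have wv: "w + v = (x + cnj x) * (y + cnj y)"
    "w * v = (y * cnj y) * (x ^ 2 + cnj x ^ 2) + (x * cnj x) * (y ^ 2 + cnj y ^ 2)"
    by (simp_all add: w_def v_def power2_eq_square algebra_simps)
  have "w + v \<in> \<int>" "w * v \<in> \<int>"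
    unfolding wv sq using x' y' by (auto intro!: Ints_add Ints_mult Ints_diff Ints_power)
  then have "\<forall>i. poly.coeff p i \<in> \<int>"
    by (auto simp: p_def coeff_pCons split: nat.splits simp del: minus_add_distrib)
  moreover have "poly p w = 0"
    by (simp add: p_def algebra_simps)
  moreover have "Polynomial.lead_coeff p = 1"
    by (simp add: p_def)
  ultimately have "algebraic_int w"
    by (intro algebraic_int.intros)
  moreover have "w \<in> \<rat>"
    using imag_quadratic_field_conj(2)[OF K] by (simp add: w_def)
  ultimately have "w \<in> \<int>"
    by (rule rational_algebraic_int_is_int)
  moreover have "x * y * cnj (x * y) = (x * cnj x) * (y * cnj y)"
    by simp
  ultimately show ?thesis
    using K x' y' unfolding ring_of_integers_iff w_def by (metis Ints_mult)
qed

section \<open>Solutions of \<open>t * s\<^sup>2 = - 1\<close> in the ring of integers\<close>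

text \<open>The squared modulus is the norm, hence a positive integer.\<close>

lemma ring_of_integers_cmod_ge_1:
  assumes "x \<in> ring_of_integers (imag_quadratic_field d)" "x \<noteq> 0"
  shows "cmod x \<ge> 1"
proof -
  have "x * cnj x \<in> \<int>"
    using assms by (simp add: ring_of_integers_iff)
  then obtain n where n: "x * cnj x = of_int n"
    by (auto elim: Ints_cases)
  then have "complex_of_real ((cmod x)\<^sup>2) = of_real (of_int n)"
    by (simp flip: complex_norm_square)
  then have "(cmod x)\<^sup>2 = of_int n"
    using of_real_eq_iff by blast
  moreover from this have "n > 0"
    using assms(2) by (metis of_int_0_less_iff zero_less_norm_iff zero_less_power)
  ultimately have "(cmod x)\<^sup>2 \<ge> 1\<^sup>2"
    by simp
  then show ?thesis
    by (rule power2_le_imp_le) simp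
qed

text \<open>With \<open>y = p / q\<close> in lowest terms,
  \<open>d * p\<^sup>2 = m * q\<^sup>2\<close> makes \<open>p\<^sup>2\<close> divide
  \<open>m\<close> and \<open>q\<^sup>2\<close> divide \<open>d\<close>, so both are 1. Used with
  \<open>m = 1\<close> and \<open>m = 3\<close> to determine \<open>d\<close>.\<close>

lemma squarefree_mult_square_eq:
  fixes d m :: nat and y :: rat
  assumes "squarefree d" "squarefree m" "of_nat d * y ^ 2 = of_nat m"
  shows "d = m"
proof -
  obtain p q :: int where pq: "y = of_int p / of_int q" "q > 0" "Rings.coprime p q"
    by (cases y) (auto simp: Fract_of_int_quotient)
  have "of_int (int d * p ^ 2) = (of_int (int m * q ^ 2) :: rat)"
    using assms(3) pq by (simp add: field_simps power2_eq_square)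
  then have eq: "int d * p ^ 2 = int m * q ^ 2"
    by linarith
  have "Rings.coprime (p ^ 2) (q ^ 2)"
    using pq by simp
  then have "p ^ 2 dvd int m" "q ^ 2 dvd int d"
    using eq by (metis coprime_dvd_mult_left_iff coprime_commute dvd_triv_right)+
  then have "(nat \<bar>p\<bar>) ^ 2 dvd m" "(nat \<bar>q\<bar>) ^ 2 dvd d"
    by (metis abs_dvd_iff nat_abs_int_diff nat_dvd_iff power_abs int_dvd_int_iff nat_0_le abs_ge_zero of_nat_power)+
  then have "nat \<bar>p\<bar> = 1" "nat \<bar>q\<bar> = 1"
    using assms(1,2) unfolding squarefree_def by (metis nat_dvd_1_iff_1)+
  then have "p ^ 2 = 1" "q ^ 2 = 1"
    by (auto simp: power2_eq_1_iff)
  then show ?thesis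
    using eq by simp
qed

text \<open>Both moduli are at least 1, so \<open>s\<close> has modulus 1 and is a root of
  \<open>X\<^sup>2 - n * X + 1\<close> with integral trace \<open>n\<close> between -2 and 2. The
  values 2 and -2 give \<open>s = 1\<close> and \<open>s = - 1\<close>; the others constrain
  \<open>d\<close> through the norm equation.\<close>

lemma ring_of_integers_neg_square_unit:
  assumes d: "d = 0 \<or> squarefree d"
    and s: "s \<in> ring_of_integers (imag_quadratic_field d)"
    and t: "t \<in> ring_of_integers (imag_quadratic_field d)"
    and ts: "t * s\<^sup>2 = - 1"
  shows "s = 1 \<or> s = - 1 \<or> (d = 1 \<and> s\<^sup>2 = - 1) \<or>
    (d = 3 \<and> (s\<^sup>2 + s + 1 = 0 \<or> s\<^sup>2 - s + 1 = 0))"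
proof -
  have "s \<noteq> 0" "t \<noteq> 0"
    using ts by auto
  then have ge: "cmod s \<ge> 1" "cmod t \<ge> 1"
    using s t ring_of_integers_cmod_ge_1 by blast+
  have "cmod t * (cmod s)\<^sup>2 = 1"
    using arg_cong[OF ts, of cmod] by (simp add: norm_mult norm_power)
  \<comment> \<open>This bounds \<open>cmod s\<close> above by
    \<open>cmod t * (cmod s)\<^sup>2 = 1\<close>.\<close>
  moreover have "1 * (cmod s * 1) \<le> cmod t * (cmod s * cmod s)"
    using ge by (intro mult_mono) auto
  ultimately have "cmod s = 1"
    using ge by (simp add: power2_eq_square)
  then have norm: "s * cnj s = 1"
    by (simp flip: complex_norm_square)
  obtain n where n: "s + cnj s = of_int n"
    using s by (auto simp: ring_of_integers_iff elim: Ints_cases)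
  have Re: "2 * Re s = of_int n"
    using arg_cong[OF n, of Re] by simp
  have "\<bar>Re s\<bar> \<le> 1"
    using abs_Re_le_cmod[of s] \<open>cmod s = 1\<close> by simp
  then have "- 2 \<le> real_of_int n" "real_of_int n \<le> 2"
    using Re by linarith+
  then have "- 2 \<le> n" "n \<le> 2"
    by linarith+
  then have n_cases: "n \<in> {-2, -1, 0, 1, 2}"
    by auto
  have quad: "s\<^sup>2 + 1 = of_int n * s"
    unfolding n[symmetric] norm[symmetric] by (simp add: algebra_simps power2_eq_square)
  \<comment> \<open>Coordinates of type \<open>rat\<close> bring the norm equation into the form
    required by \<open>squarefree_mult_square_eq\<close>.\<close>
  obtain a b :: rat where ab: "s = of_rat a + of_rat b * csqrt (- of_nat d)"
    using s unfolding ring_of_integers_iff by (auto simp only: imag_quadratic_field_eq elim!: Rats_cases)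
  have Re_Im: "Re s = of_rat a" "Im s = of_rat b * sqrt d"
    unfolding ab csqrt_neg_of_nat by (simp_all add: Re_of_rat Im_of_rat)
  have "(of_rat (2 * a) :: real) = of_rat (of_int n)"
    using Re unfolding Re_Im by (simp add: of_rat_mult)
  then have a: "2 * a = of_int n"
    by (simp only: of_rat_eq_iff)
  have "(Re s)\<^sup>2 + (Im s)\<^sup>2 = 1"
    using \<open>cmod s = 1\<close> by (simp add: cmod_def)
  then have "(of_rat (a ^ 2 + of_nat d * b ^ 2) :: real) = of_rat 1"
    unfolding Re_Im by (simp add: of_rat_mult of_rat_add of_rat_power power_mult_distrib mult.commute)
  then have b: "a ^ 2 + of_nat d * b ^ 2 = 1"
    by (simp only: of_rat_eq_iff)
  consider "n = 2" | "n = -2" | "n = 0" | "n = 1 \<or> n = -1"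
    using n_cases by auto
  then show ?thesis
  proof cases
    case 1
    then have "(s - 1)\<^sup>2 = 0"
      using quad by (simp add: power2_eq_square algebra_simps)
    then show ?thesis by simp
  next
    case 2
    have "(s + 1)\<^sup>2 = s\<^sup>2 + 1 + 2 * s"
      by (simp add: power2_eq_square algebra_simps)
    then have "(s + 1)\<^sup>2 = 0"
      using quad 2 by simp
    then show ?thesis by (simp add: add_eq_0_iff2)
  next
    case 3
    \<comment> \<open>Trace 0 means \<open>a = 0\<close>. The resulting equation rules out
      \<open>d = 0\<close>, so \<open>d\<close> is squarefree.\<close>
    then have db: "of_nat d * b ^ 2 = of_nat 1"
      using a b by simp
    then have "squarefree d"
      using d by auto
    then have "d = 1"
      using squarefree_mult_square_eq[OF _ _ db] by simp
    moreover have "s\<^sup>2 = - 1"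
      using quad 3 by (simp add: eq_neg_iff_add_eq_0)
    ultimately show ?thesis by simp
  next
    case 4
    then have "(2 * a) ^ 2 = 1"
      using a by auto
    \<comment> \<open>Here \<open>a\<close> is 1/2 or -1/2; multiplying the norm equation by 4
      leaves 3 on the right, which again excludes \<open>d = 0\<close>.\<close>
    then have db: "of_nat d * (2 * b) ^ 2 = of_nat 3"
      using b by (simp add: power_mult_distrib)
    then have "squarefree d"
      using d by auto
    then have "d = 3"
      using squarefree_mult_square_eq[OF _ _ db] by (simp add: squarefree_prime)
    moreover have "s\<^sup>2 + s + 1 = 0 \<or> s\<^sup>2 - s + 1 = 0"
    proof -
      have "s\<^sup>2 + s + 1 = (s\<^sup>2 + 1) + s" "s\<^sup>2 - s + 1 = (s\<^sup>2 + 1) - s"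
        by simp_all
      then show ?thesis
        using 4 quad by (metis add.commute add.right_inverse diff_self mult_1 mult_minus1 of_int_1 of_int_minus)
    qed
    ultimately show ?thesis by simp
  qed
qed

lemma imaginary_unit_in_ring_of_integers: "\<i> \<in> ring_of_integers (imag_quadratic_field 1)"
proof -
  have "\<i> = 0 + 1 * csqrt (- of_nat 1)"
    by simp
  then have "\<i> \<in> imag_quadratic_field 1"
    unfolding imag_quadratic_field_eq using Rats_0 Rats_1 by blast
  then show ?thesis
    by (simp add: ring_of_integers_def)
qed

text \<open>Completing the square shows that \<open>2 * \<omega> + 1\<close> is one of the two
  square roots of -3. Both signs are treated, since either primitive root may be
  \<open>\<omega>\<close>.\<close>

lemma cube_root_of_unity_in_ring_of_integers:
  assumes "\<omega>\<^sup>2 + \<omega> + 1 = 0"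
  shows "\<omega> \<in> ring_of_integers (imag_quadratic_field 3)"
proof -
  have "(2 * \<omega> + 1)\<^sup>2 = 4 * (\<omega>\<^sup>2 + \<omega> + 1) - 3"
    by (simp add: power2_eq_square algebra_simps)
  then have "(2 * \<omega> + 1)\<^sup>2 = (csqrt (- of_nat 3))\<^sup>2"
    unfolding power2_csqrt assms by simp
  then have "2 * \<omega> + 1 = csqrt (- of_nat 3) \<or> 2 * \<omega> + 1 = - csqrt (- of_nat 3)"
    by (simp only: power2_eq_iff)
  moreover have "\<omega> = - (1/2) + (1/2) * y" if "2 * \<omega> + 1 = y" for y
    using that by (auto simp: field_simps)
  ultimately have "\<omega> = - (1/2) + (1/2) * csqrt (- of_nat 3) \<or> \<omega> = - (1/2) + (- (1/2)) * csqrt (- of_nat 3)"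
    by (metis minus_mult_commute)
  moreover have "- (1/2 :: complex) \<in> \<rat>" "1/2 \<in> (\<rat> :: complex set)"
    by auto
  ultimately have "\<omega> \<in> imag_quadratic_field 3"
    unfolding imag_quadratic_field_eq by blast
  moreover have "algebraic_int \<omega>"
  proof
    show "Polynomial.lead_coeff [:1, 1, 1:] = (1 :: complex)"
      by simp
    show "\<forall>i. poly.coeff [:1, 1, 1 :: complex:] i \<in> \<int>"
      by (auto simp: coeff_pCons split: nat.splits)
    show "poly [:1, 1, 1:] \<omega> = 0"
      using assms by (simp add: power2_eq_square algebra_simps)
  qed
  ultimately show ?thesis
    by (simp add: ring_of_integers_def)
qed

section \<open>Girth and components of digraphs\<close>

lemma girth_geI:
  assumes "\<And>p. pre_digraph.cycle G p \<Longrightarrow> 3 \<le> length p \<Longrightarrow> n \<le> length p"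
  shows "enat n \<le> girth G"
  unfolding girth_def by (rule INF_greatest) (use assms in auto)

lemma girth_leI:
  assumes "pre_digraph.cycle G p" "3 \<le> length p"
  shows "girth G \<le> enat (length p)"
  unfolding girth_def by (rule INF_lower) (use assms in auto)

text \<open>The lower bound is built into \<open>girth\<close>, which counts only cycles of length
  at least 3.\<close>

lemma girth_eq_3I:
  assumes "pre_digraph.cycle G p" "length p = 3"
  shows "girth G = 3"
proof (rule antisym)
  show "girth G \<le> 3"
    using girth_leI[OF assms(1)] assms(2) by (simp flip: numeral_eq_enat)
  show "3 \<le> girth G"
    using girth_geI[of G 3] by (simp flip: numeral_eq_enat)
qed

lemma girth_triangle:
  fixes G :: "'a pair_pre_digraph"
  assumes "(a, b) \<in> parcs G" "(b, c) \<in> parcs G" "(c, a) \<in> parcs G"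
    and "distinct [a, b, c]" "a \<in> pverts G"
  shows "girth G = 3"
proof (rule girth_eq_3I)
  show "pre_digraph.cycle G [(a, b), (b, c), (c, a)]"
    using assms unfolding pre_digraph.cycle_def pre_digraph.awalk_def
    by (intro exI[of _ a]) (auto simp: pre_digraph.cas.simps pre_digraph.awalk_verts.simps)
qed simp

text \<open>Two vertices on each side give a 4-cycle, and a closed walk cannot switch sides three
  times.\<close>

lemma girth_complete_bipartite:
  fixes G :: "('a, 'a \<times> 'a) pre_digraph"
  assumes "tail G = fst" "head G = snd" "verts G = U \<union> V"
    and arcs: "arcs G = U \<times> V \<union> V \<times> U" and "U \<inter> V = {}"
    and "u \<in> U" "u' \<in> U" "u \<noteq> u'" "v \<in> V" "v' \<in> V" "v \<noteq> v'"
  shows "girth G = 4"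
proof (rule antisym)
  have "pre_digraph.cycle G [(u, v), (v, u'), (u', v'), (v', u)]"
    using assms unfolding pre_digraph.cycle_def pre_digraph.awalk_def
    by (intro exI[of _ u]) (auto simp: pre_digraph.cas.simps pre_digraph.awalk_verts.simps)
  then show "girth G \<le> 4"
    using girth_leI[of G "[(u, v), (v, u'), (u', v'), (v', u)]"]
    by (simp add: numeral_eq_enat numeral_eq_Suc)
  have ne3: "length p \<noteq> 3" if "pre_digraph.cycle G p" for p
  proof
    assume "length p = 3"
    then obtain e1 e2 e3 where "p = [e1, e2, e3]"
      by (auto simp: numeral_3_eq_3 length_Suc_conv)
    moreover from this that have "set [e1, e2, e3] \<subseteq> arcs G"
      and *: "head G e1 = tail G e2" "head G e2 = tail G e3" "head G e3 = tail G e1"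
      unfolding pre_digraph.cycle_def pre_digraph.awalk_def by (auto simp: pre_digraph.cas.simps)
    then have alt: "(fst e \<in> U) = (snd e \<notin> U)" if "e \<in> {e1, e2, e3}" for e
      using that assms(5) unfolding arcs by (cases e) auto
    show False
      using * alt[of e1] alt[of e2] alt[of e3] unfolding \<open>tail G = fst\<close> \<open>head G = snd\<close> by auto
  qed
  have "enat 4 \<le> girth G"
  proof (rule girth_geI)
    fix p assume "pre_digraph.cycle G p" "3 \<le> length p"
    then show "4 \<le> length p"
      using ne3[of p] by linarith
  qed
  then show "4 \<le> girth G"
    by (simp flip: numeral_eq_enat)
qed

section \<open>Components from a partition into blocks\<close>

lemma induced_subgraph_eq_induce: "induced_subgraph H G \<Longrightarrow> H = G \<restriction> verts H"
  by (rule pre_digraph.equality) (simp_all add: induced_subgraph_def subgraph_def compatible_def)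

text \<open>No arc crosses the boundary of \<open>B\<close>, so a walk that may use arcs in either
  direction never leaves it.\<close>

lemma connected_block:
  assumes block: "\<And>e. e \<in> arcs G \<Longrightarrow> (tail G e \<in> B) = (head G e \<in> B)"
    and H: "induced_subgraph H G" "Digraph_Component.connected H"
    and v: "v \<in> verts H" "v \<in> B"
  shows "verts H \<subseteq> B"
proof
  fix w assume "w \<in> verts H"
  then have "v \<rightarrow>\<^sup>*\<^bsub>mk_symmetric H\<^esub> w"
    using H(2) v(1) by (auto simp: Digraph_Component.connected_def strongly_connected_def)
  then show "w \<in> B"
    unfolding reachable_def
  proof (induction rule: rtrancl_on_induct)
    case (step y z)
    then show ?case
      using block H(1) unfolding induced_subgraph_def subgraph_def compatible_def
      by (auto simp: parcs_mk_symmetric)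
  qed (rule v)
qed

text \<open>By \<open>connected_block\<close> every connected induced subgraph lies in the block of
  any of its vertices, and the blocks are connected themselves, so they are the maximal ones.
  Connected digraphs are nonempty, which supplies the vertex.\<close>

lemma digraph_components_partition:
  assumes wf: "wf_digraph G"
    and cover: "\<Union>P = verts G"
    and block: "\<And>B e. B \<in> P \<Longrightarrow> e \<in> arcs G \<Longrightarrow> (tail G e \<in> B) = (head G e \<in> B)"
    and conn: "\<And>B. B \<in> P \<Longrightarrow> Digraph_Component.connected (G \<restriction> B)"
  shows "digraph_components G = (\<lambda>B. G \<restriction> B) ` P"
proof (intro equalityI subsetI)
  have ind: "induced_subgraph (G \<restriction> B) G" if "B \<in> P" for B
    using that cover by (intro wf_digraph.induced_induce[OF wf]) auto
  have ne: "verts H \<noteq> {}" if "Digraph_Component.connected H" for H :: "('a, 'b) pre_digraph"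
    using that by (auto simp: Digraph_Component.connected_def strongly_connected_def)
  {
    fix H assume "H \<in> digraph_components G"
    then have H: "induced_subgraph H G" "Digraph_Component.connected H"
      and max: "\<And>H'. induced_subgraph H' G \<Longrightarrow> Digraph_Component.connected H' \<Longrightarrow> \<not> verts H \<subset> verts H'"
      unfolding digraph_components_def by blast+
    obtain v where v: "v \<in> verts H"
      using ne[OF H(2)] by blast
    have "verts H \<subseteq> verts G"
      using H(1) by (simp add: induced_subgraph_def subgraph_def)
    then obtain B where B: "B \<in> P" "v \<in> B"
      using cover v by blast
    have "verts H \<subseteq> B"
      using connected_block[OF block[OF B(1)] H v B(2)] .
    moreover have "\<not> verts H \<subset> B"
      using max[OF ind[OF B(1)] conn[OF B(1)]] by simp
    ultimately have "verts H = B" by blast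
    then show "H \<in> (\<lambda>B. G \<restriction> B) ` P"
      using B induced_subgraph_eq_induce[OF H(1)] by blast
  next
    fix H assume "H \<in> (\<lambda>B. G \<restriction> B) ` P"
    then obtain B where B: "B \<in> P" "H = G \<restriction> B" by auto
    have "\<not> (\<exists>H'. induced_subgraph H' G \<and> Digraph_Component.connected H' \<and> B \<subset> verts H')"
    proof
      assume "\<exists>H'. induced_subgraph H' G \<and> Digraph_Component.connected H' \<and> B \<subset> verts H'"
      then obtain H' where H': "induced_subgraph H' G" "Digraph_Component.connected H'" "B \<subset> verts H'"
        by blast
      obtain v where "v \<in> B"
        using ne[OF conn[OF B(1)]] by auto
      then show False
        using connected_block[OF block[OF B(1)] H'(1,2), of v] H'(3) by blast
    qed
    then show "H \<in> digraph_components G"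
      using ind[OF B(1)] conn[OF B(1)] unfolding digraph_components_def B(2) by simp
  }
qed

text \<open>Reachability in the symmetric closure can be reversed, so any two vertices are joined
  through the hub \<open>h\<close>.\<close>

lemma (in wf_digraph) connected_if_reachable_from:
  assumes "h \<in> verts G" "\<And>v. v \<in> verts G \<Longrightarrow> h \<rightarrow>\<^sup>*\<^bsub>mk_symmetric G\<^esub> v"
  shows "Digraph_Component.connected G"
proof (rule connectedI)
  interpret sG: pair_wf_digraph "mk_symmetric G" ..
  fix u v assume "u \<in> verts G" "v \<in> verts G"
  then show "u \<rightarrow>\<^sup>*\<^bsub>mk_symmetric G\<^esub> v"
    using assms(2) symmetric_reachable[OF symmetric_mk_symmetric] sG.reachable_trans by metis
qed (use assms in auto)

section \<open>The zero-divisor graph on the twisted cubic\<close>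

abbreviation entry :: "'a^'n^'m \<Rightarrow> 'm \<Rightarrow> 'n \<Rightarrow> 'a" where
  "entry A i j \<equiv> vec_nth (vec_nth A i) j"

text \<open>The entries are the multiple by \<open>c\<close> of the point
  \<open>(1, t, t\<^sup>2, t\<^sup>3)\<close> of the twisted cubic.\<close>

definition tc_mat :: "complex \<Rightarrow> complex \<Rightarrow> complex^2^2" where
  "tc_mat c t = map_matrix ((*) c) (vector [vector [1, t], vector [t^2, t^3]])"

text \<open>The multiples of the point at infinity \<open>(0, 0, 0, 1)\<close> of the twisted
  cubic.\<close>

definition corner_mat :: "complex \<Rightarrow> complex^2^2" where
  "corner_mat c = vector [vector [0, 0], vector [0, c]]"

lemma tc_mat_nth [simp]:
  "entry (tc_mat c t) 1 1 = c" "entry (tc_mat c t) 1 2 = c * t"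
  "entry (tc_mat c t) 2 1 = c * t^2" "entry (tc_mat c t) 2 2 = c * t^3"
  by (simp_all add: tc_mat_def map_matrix_def)

lemma corner_mat_nth [simp]:
  "entry (corner_mat c) 1 1 = 0" "entry (corner_mat c) 1 2 = 0"
  "entry (corner_mat c) 2 1 = 0" "entry (corner_mat c) 2 2 = c"
  by (simp_all add: corner_mat_def)

lemma mat2_eq_iff:
  "(A :: 'a^2^2) = B \<longleftrightarrow> entry A 1 1 = entry B 1 1 \<and> entry A 1 2 = entry B 1 2 \<and> entry A 2 1 = entry B 2 1 \<and> entry A 2 2 = entry B 2 2"
  by (auto simp: vec_eq_iff forall_2)

lemma matrix_mult_nth_2: "entry (A ** B) i j = entry A i 1 * entry B 1 j + entry A i 2 * entry B 2 j"
  for A B :: "'a::semiring_1^2^2"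
  by (simp add: matrix_matrix_mult_def sum_2)

lemma tc_mat_eq_iff: "c \<noteq> 0 \<Longrightarrow> tc_mat c t = tc_mat e s \<longleftrightarrow> c = e \<and> t = s"
  by (auto simp: mat2_eq_iff)

lemma tc_mat_neq_corner_mat: "c \<noteq> 0 \<Longrightarrow> tc_mat c t \<noteq> corner_mat e"
  by (auto simp: mat2_eq_iff)

lemma tc_mat_mult_eq_0_iff:
  assumes "c \<noteq> 0" "e \<noteq> 0"
  shows "tc_mat c t ** tc_mat e s = 0 \<longleftrightarrow> t * s\<^sup>2 = - 1"
proof -
  let ?k = "c * e * (1 + t * s\<^sup>2)"
  \<comment> \<open>All four entries are multiples of \<open>?k\<close>, and the first is
    \<open>?k\<close> itself, so the product vanishes exactly with \<open>?k\<close>.\<close>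
  have nth: "entry (tc_mat c t ** tc_mat e s) 1 1 = ?k" "entry (tc_mat c t ** tc_mat e s) 1 2 = ?k * s"
    "entry (tc_mat c t ** tc_mat e s) 2 1 = ?k * t\<^sup>2" "entry (tc_mat c t ** tc_mat e s) 2 2 = ?k * t\<^sup>2 * s"
    by (simp_all add: matrix_mult_nth_2 algebra_simps power2_eq_square power3_eq_cube)
  have "tc_mat c t ** tc_mat e s = 0 \<longleftrightarrow> ?k = 0"
    unfolding mat2_eq_iff nth by auto
  also have "\<dots> \<longleftrightarrow> 1 + t * s\<^sup>2 = 0"
    using assms by simp
  finally show ?thesis
    by (simp add: add_eq_0_iff)
qed

lemma tc_mat_mult_corner_mat_eq_0_iff:
  "c \<noteq> 0 \<Longrightarrow> e \<noteq> 0 \<Longrightarrow> tc_mat c t ** corner_mat e = 0 \<longleftrightarrow> t = 0"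
  "c \<noteq> 0 \<Longrightarrow> e \<noteq> 0 \<Longrightarrow> corner_mat e ** tc_mat c t = 0 \<longleftrightarrow> t = 0"
  by (auto simp: mat2_eq_iff matrix_mult_nth_2)

lemma corner_mat_mult_neq_0: "c \<noteq> 0 \<Longrightarrow> e \<noteq> 0 \<Longrightarrow> corner_mat c ** corner_mat e \<noteq> 0"
  by (auto simp: mat2_eq_iff matrix_mult_nth_2)

lemma Stc1t_eq: "Stc1t R t = (\<lambda>c. tc_mat c t) ` (R - {0})"
  by (auto simp: Stc1t_def tc_mat_def)

lemma Stc2_eq: "Stc2 R = corner_mat ` (R - {0})"
  by (auto simp: Stc2_def corner_mat_def)

lemma Stc1t_disjoint: "t \<noteq> s \<Longrightarrow> Stc1t R t \<inter> Stc1t R s = {}"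
  by (auto simp: Stc1t_eq tc_mat_eq_iff)

lemma Stc1t_Stc2_disjoint: "Stc1t R t \<inter> Stc2 R = {}"
  by (auto simp: Stc1t_eq Stc2_eq tc_mat_neq_corner_mat)

lemma tc_mat_in_Stc1t_iff: "c \<noteq> 0 \<Longrightarrow> tc_mat c t \<in> Stc1t R s \<longleftrightarrow> c \<in> R \<and> t = s"
  by (auto simp: Stc1t_eq tc_mat_eq_iff)

lemma tc_mat_notin_Stc2: "c \<noteq> 0 \<Longrightarrow> tc_mat c t \<notin> Stc2 R"
  by (auto simp: Stc2_eq tc_mat_neq_corner_mat)

lemma corner_mat_in_Stc2_iff: "corner_mat c \<in> Stc2 R \<longleftrightarrow> c \<in> R - {0}"
  by (auto simp: Stc2_eq mat2_eq_iff)

section \<open>The graph over a multiplicatively closed set containing the integers\<close>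

text \<open>The integers supply infinitely many scalars and the witnesses 1, 2, 3; closure under
  products keeps the matrix entries in \<open>R\<close>.\<close>

locale tc_graph =
  fixes R :: "complex set"
  assumes Ints_subset: "\<int> \<subseteq> R"
    and mult_closed: "x \<in> R \<Longrightarrow> y \<in> R \<Longrightarrow> x * y \<in> R"
begin

definition tcg :: "(complex^2^2, (complex^2^2) \<times> (complex^2^2)) pre_digraph" where
  "tcg = zero_divisor_graph (M2 R) \<restriction> Stc R"

lemma numeral_closed [simp]: "0 \<in> R" "1 \<in> R" "-1 \<in> R" "numeral n \<in> R"
  using Ints_subset by auto

lemma minus_closed: "x \<in> R \<Longrightarrow> - x \<in> R"
  using mult_closed[of "-1" x] by simp

lemma power_closed: "x \<in> R \<Longrightarrow> x ^ n \<in> R"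
  by (induction n) (auto intro: mult_closed)

lemma Stc_cases:
  assumes "v \<in> Stc R"
  obtains c t where "c \<in> R" "c \<noteq> 0" "t \<in> R" "v = tc_mat c t"
    | c where "c \<in> R" "c \<noteq> 0" "v = corner_mat c"
  using assms by (auto simp: Stc_def Stc1_def Stc1t_eq Stc2_eq)

lemma Stc1t_subset_Stc: "t \<in> R \<Longrightarrow> Stc1t R t \<subseteq> Stc R"
  by (auto simp: Stc_def Stc1_def)

lemma Stc2_subset_Stc: "Stc2 R \<subseteq> Stc R"
  by (auto simp: Stc_def)

text \<open>This lets \<open>arcs_tcg\<close> replace the zero-divisor condition on end points by
  membership in \<open>Stc R\<close>.\<close>

lemma Stc_subset_zero_divisors: "Stc R \<subseteq> zero_divisors (M2 R) - {0}"
proof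
  fix v assume "v \<in> Stc R"
  then show "v \<in> zero_divisors (M2 R) - {0}"
  proof (cases rule: Stc_cases)
    case (1 c t)
    \<comment> \<open>The column \<open>(- t, 1)\<close> is annihilated by the row
      \<open>(1, t)\<close>, to which all rows of \<open>v\<close> are proportional.\<close>
    define w :: "complex^2^2" where "w = vector [vector [- t, 0], vector [1, 0]]"
    have w: "entry w 1 1 = - t" "entry w 1 2 = 0" "entry w 2 1 = 1" "entry w 2 2 = 0"
      by (simp_all add: w_def)
    have "v ** w = 0"
      by (simp add: mat2_eq_iff matrix_mult_nth_2 w 1 power2_eq_square power3_eq_cube)
    moreover have "w \<noteq> 0" "v \<noteq> 0"
      using 1 w by (auto simp: mat2_eq_iff)
    moreover have "w \<in> carrier (M2 R)" "v \<in> carrier (M2 R)"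
      using 1 w by (auto simp: M2_def forall_2 minus_closed mult_closed power_closed)
    ultimately show ?thesis
      unfolding zero_divisors_def by (auto simp: M2_def)
  next
    case (2 c)
    have "v ** tc_mat 1 0 = 0"
      using 2 by (simp add: tc_mat_mult_corner_mat_eq_0_iff)
    moreover have "tc_mat 1 0 \<noteq> 0" "v \<noteq> 0"
      using 2 by (auto simp: mat2_eq_iff)
    moreover have "tc_mat 1 0 \<in> carrier (M2 R)" "v \<in> carrier (M2 R)"
      using 2 by (auto simp: M2_def forall_2)
    ultimately show ?thesis
      unfolding zero_divisors_def by (auto simp: M2_def)
  qed
qed

lemma tcg_simps [simp]: "verts tcg = Stc R" "tail tcg = fst" "head tcg = snd"
  by (simp_all add: tcg_def)

lemma arcs_tcg: "arcs tcg = {(v, w). v \<in> Stc R \<and> w \<in> Stc R \<and> v \<noteq> w \<and> v ** w = 0}"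
  using Stc_subset_zero_divisors by (auto simp: tcg_def zero_divisor_graph_def M2_def)

lemma wf_tcg: "wf_digraph tcg"
  by unfold_locales (auto simp: arcs_tcg)

lemma wf_induce: "wf_digraph (tcg \<restriction> B)"
  by (rule wf_digraph.wellformed_induce_subgraph[OF wf_tcg])

lemma arcs_induce:
  "B \<subseteq> Stc R \<Longrightarrow> arcs (tcg \<restriction> B) = {(v, w). v \<in> B \<and> w \<in> B \<and> v \<noteq> w \<and> v ** w = 0}"
  by (auto simp: arcs_tcg)

lemma arcs_ends_induce: "arcs_ends (tcg \<restriction> B) = arcs (tcg \<restriction> B)"
  by (auto simp: arcs_ends_def arc_to_ends_def)

lemma parcs_mk_symmetric_induce:
  assumes "B \<subseteq> Stc R"
  shows "parcs (mk_symmetric (tcg \<restriction> B)) =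
    {(v, w). v \<in> B \<and> w \<in> B \<and> v \<noteq> w \<and> (v ** w = 0 \<or> w ** v = 0)}"
  using arcs_induce[OF assms] by (force simp: parcs_mk_symmetric)

lemma reachable_mk_symmetric:
  assumes "B \<subseteq> Stc R" "v \<in> B" "w \<in> B" "v ** w = 0 \<or> w ** v = 0"
  shows "v \<rightarrow>\<^sup>*\<^bsub>mk_symmetric (tcg \<restriction> B)\<^esub> w"
proof -
  interpret wf_digraph "tcg \<restriction> B" by (rule wf_induce)
  interpret s: pair_wf_digraph "mk_symmetric (tcg \<restriction> B)" ..
  show ?thesis
  proof (cases "v = w")
    case False
    then have "(v, w) \<in> parcs (mk_symmetric (tcg \<restriction> B))"
      using assms by (simp add: parcs_mk_symmetric_induce)
    then show ?thesis
      by (intro s.reachable_adjI) simp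
  qed (use assms in simp)
qed

text \<open>In each large component a suitable hub reaches every vertex within two arcs, so this
  criterion covers them all.\<close>

lemma connected_if_two_steps:
  assumes "B \<subseteq> Stc R" "h \<in> B"
    and "\<And>v. v \<in> B \<Longrightarrow> h ** v = 0 \<or> (\<exists>w\<in>B. h ** w = 0 \<and> w ** v = 0)"
  shows "Digraph_Component.connected (tcg \<restriction> B)"
proof -
  interpret wf_digraph "tcg \<restriction> B" by (rule wf_induce)
  interpret s: pair_wf_digraph "mk_symmetric (tcg \<restriction> B)" ..
  show ?thesis
  proof (rule connected_if_reachable_from)
    fix v assume "v \<in> verts (tcg \<restriction> B)"
    then have v: "v \<in> B" by simp
    then show "h \<rightarrow>\<^sup>*\<^bsub>mk_symmetric (tcg \<restriction> B)\<^esub> v"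
      using assms by (meson s.reachable_trans reachable_mk_symmetric)
  qed (use assms in simp)
qed

lemma connected_singleton: "Digraph_Component.connected (tcg \<restriction> {v})"
  by (rule wf_digraph.connected_if_reachable_from[OF wf_induce, of v])
    (auto simp: reachable_def)

text \<open>Expresses that an isolated vertex forms a \<open>K_1\<close>: the graph has no loops, so
  no arc remains on one vertex.\<close>

lemma complete_digraph_singleton:
  assumes "v \<in> Stc R"
  shows "complete_digraph 1 (tcg \<restriction> {v})"
proof -
  have arcs: "arcs (tcg \<restriction> {v}) = {}"
    using assms by (simp only: arcs_induce insert_subset empty_subsetI) auto
  interpret wf_digraph "tcg \<restriction> {v}" by (rule wf_induce)
  have "graph (tcg \<restriction> {v})"
    by unfold_locales (auto simp: arcs arcs_ends_induce symmetric_def simp del: induce_subgraph_arcs)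
  then show ?thesis
    unfolding complete_digraph_def arcs_ends_induce arcs by auto
qed

lemma infinite_Stc1t: "infinite (Stc1t R t)"
proof -
  have "infinite (of_nat ` {1..} :: complex set)"
    by (subst finite_image_iff) (auto simp: inj_on_def infinite_Ici)
  moreover have "of_nat ` {1..} \<subseteq> R - {0}"
    using Ints_subset by auto
  ultimately have "infinite (R - {0})"
    using finite_subset by blast
  moreover have "inj_on (\<lambda>c. tc_mat c t) (R - {0})"
    by (auto simp: inj_on_def tc_mat_eq_iff)
  ultimately show ?thesis
    by (simp add: Stc1t_eq finite_image_iff)
qed

lemma bipartite_subset_Stc: "Stc1t R 0 \<union> Stc2 R \<subseteq> Stc R"
  using Stc1t_subset_Stc[of 0] Stc2_subset_Stc by simp

text \<open>With both parameters 0 the condition \<open>t * s\<^sup>2 = - 1\<close> fails, and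
  products of corner matrices are nonzero, so neither part has inner arcs; mixed products vanish in
  both orders.\<close>

lemma arcs_bipartite:
  "arcs (tcg \<restriction> (Stc1t R 0 \<union> Stc2 R)) = Stc1t R 0 \<times> Stc2 R \<union> Stc2 R \<times> Stc1t R 0"
  unfolding arcs_induce[OF bipartite_subset_Stc]
  by (auto simp: Stc1t_eq Stc2_eq tc_mat_mult_eq_0_iff tc_mat_mult_corner_mat_eq_0_iff
      corner_mat_mult_neq_0 dest: tc_mat_neq_corner_mat tc_mat_neq_corner_mat[THEN not_sym])

lemma complete_bipartite_tcg: "complete_bipartite (tcg \<restriction> (Stc1t R 0 \<union> Stc2 R))"
proof -
  have "tc_mat 1 0 \<in> Stc1t R 0" "corner_mat 1 \<in> Stc2 R"
    by (auto simp: tc_mat_in_Stc1t_iff corner_mat_in_Stc2_iff)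
  then show ?thesis
    unfolding complete_bipartite_def arcs_ends_induce arcs_bipartite
    using Stc1t_Stc2_disjoint by (intro exI[of _ "Stc1t R 0"] exI[of _ "Stc2 R"]) auto
qed

lemma girth_bipartite: "girth (tcg \<restriction> (Stc1t R 0 \<union> Stc2 R)) = 4"
  by (rule girth_complete_bipartite[OF _ _ _ arcs_bipartite Stc1t_Stc2_disjoint,
      of "tc_mat 1 0" "tc_mat 2 0" "corner_mat 1" "corner_mat 2"])
    (auto simp: tc_mat_in_Stc1t_iff corner_mat_in_Stc2_iff tc_mat_eq_iff mat2_eq_iff)

lemma connected_bipartite: "Digraph_Component.connected (tcg \<restriction> (Stc1t R 0 \<union> Stc2 R))"
proof (rule connected_if_two_steps[OF bipartite_subset_Stc, of "tc_mat 1 0"])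
  fix v assume "v \<in> Stc1t R 0 \<union> Stc2 R"
  then show "tc_mat 1 0 ** v = 0 \<or> (\<exists>w\<in>Stc1t R 0 \<union> Stc2 R. tc_mat 1 0 ** w = 0 \<and> w ** v = 0)"
  proof
    assume "v \<in> Stc1t R 0"
    then obtain c where "c \<noteq> 0" "v = tc_mat c 0"
      by (auto simp: Stc1t_eq)
    then show ?thesis
      by (intro disjI2 bexI[of _ "corner_mat 1"])
        (simp_all add: tc_mat_mult_corner_mat_eq_0_iff corner_mat_in_Stc2_iff)
  next
    assume "v \<in> Stc2 R"
    then obtain c where "c \<noteq> 0" "v = corner_mat c"
      by (auto simp: Stc2_eq)
    then show ?thesis
      by (simp add: tc_mat_mult_corner_mat_eq_0_iff)
  qed
qed (simp add: tc_mat_in_Stc1t_iff)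

text \<open>\<open>B\<close> may exceed the two families of \<open>u\<close> and \<open>- u\<close>,
  so that the results also apply to the four families for \<open>d = 1\<close>.\<close>

context
  fixes u :: complex and B :: "(complex^2^2) set"
  assumes u: "u \<in> R" "u ^ 3 = 1"
    and B: "Stc1t R (- u) \<union> Stc1t R u \<subseteq> B" "B \<subseteq> Stc R"
begin

text \<open>There is an arc from parameter \<open>- u\<close> to \<open>u\<close>, as
  \<open>- u * u\<^sup>2 = - 1\<close>, but none back, as
  \<open>u * (- u)\<^sup>2 = 1\<close>.\<close>

lemma not_symmetric_tcg: "\<not> symmetric (tcg \<restriction> B)"
proof
  have uu: "u * u\<^sup>2 = 1"
    using u by (simp add: power2_eq_square power3_eq_cube mult.assoc)
  have u_ne: "- u \<noteq> u"
    using u by auto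
  have in_B: "tc_mat 1 (- u) \<in> B" "tc_mat 1 u \<in> B"
    using B by (auto simp: tc_mat_in_Stc1t_iff)
  assume "symmetric (tcg \<restriction> B)"
  moreover have "(tc_mat 1 (- u), tc_mat 1 u) \<in> arcs (tcg \<restriction> B)"
    using in_B u_ne uu by (simp add: arcs_induce[OF B(2)] tc_mat_mult_eq_0_iff tc_mat_eq_iff del: induce_subgraph_arcs)
  ultimately have "(tc_mat 1 u, tc_mat 1 (- u)) \<in> arcs (tcg \<restriction> B)"
    unfolding symmetric_def arcs_ends_induce by (rule symD)
  then show False
    using uu by (simp add: arcs_induce[OF B(2)] tc_mat_mult_eq_0_iff del: induce_subgraph_arcs)
qed

text \<open>Since \<open>(- u) ^ 3 = - 1\<close>, matrices with parameter \<open>- u\<close>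
  annihilate each other; three scalars give a triangle.\<close>

lemma girth_mk_symmetric_tcg: "girth (mk_symmetric (tcg \<restriction> B)) = 3"
proof (rule girth_triangle)
  have "- u * (- u)\<^sup>2 = - 1"
    using u by (simp add: power2_eq_square power3_eq_cube mult.assoc)
  moreover have "tc_mat 1 (- u) \<in> B" "tc_mat 2 (- u) \<in> B" "tc_mat 3 (- u) \<in> B"
    using B by (auto simp: tc_mat_in_Stc1t_iff)
  ultimately show "(tc_mat 1 (- u), tc_mat 2 (- u)) \<in> parcs (mk_symmetric (tcg \<restriction> B))"
    "(tc_mat 2 (- u), tc_mat 3 (- u)) \<in> parcs (mk_symmetric (tcg \<restriction> B))"
    "(tc_mat 3 (- u), tc_mat 1 (- u)) \<in> parcs (mk_symmetric (tcg \<restriction> B))"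
    "tc_mat 1 (- u) \<in> pverts (mk_symmetric (tcg \<restriction> B))"
    using B(2) by (auto simp: parcs_mk_symmetric_induce tc_mat_mult_eq_0_iff tc_mat_eq_iff)
qed (simp add: tc_mat_eq_iff)

lemma infinite_tcg: "infinite (verts (tcg \<restriction> B))"
  using B(1) infinite_Stc1t finite_subset by auto

end

text \<open>A matrix with parameter \<open>- u\<close> has product zero with both families on its
  right, so one step from the hub suffices.\<close>

lemma connected_cube_root_pair:
  assumes u: "u \<in> R" "u ^ 3 = 1"
  shows "Digraph_Component.connected (tcg \<restriction> (Stc1t R (- u) \<union> Stc1t R u))"
proof (rule connected_if_two_steps[of _ "tc_mat 1 (- u)"])
  show "Stc1t R (- u) \<union> Stc1t R u \<subseteq> Stc R"
    using u by (simp add: Stc1t_subset_Stc minus_closed)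
  show h: "tc_mat 1 (- u) \<in> Stc1t R (- u) \<union> Stc1t R u"
    by (simp add: tc_mat_in_Stc1t_iff)
  have uu: "u * u\<^sup>2 = 1"
    using u by (simp add: power2_eq_square power3_eq_cube mult.assoc)
  fix v assume "v \<in> Stc1t R (- u) \<union> Stc1t R u"
  then obtain c t where "c \<noteq> 0" "v = tc_mat c t" "t = u \<or> t = - u"
    by (auto simp: Stc1t_eq)
  then show "tc_mat 1 (- u) ** v = 0 \<or>
      (\<exists>w\<in>Stc1t R (- u) \<union> Stc1t R u. tc_mat 1 (- u) ** w = 0 \<and> w ** v = 0)"
    using uu by (auto simp: tc_mat_mult_eq_0_iff)
qed

text \<open>Parameter -1 has arcs to the parameters of square 1; those of square -1 are reached from
  it through parameter 1.\<close>

lemma connected_fourth_roots: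
  assumes "\<i> \<in> R"
  shows "Digraph_Component.connected (tcg \<restriction> (Stc1t R (-1) \<union> Stc1t R 1 \<union> Stc1t R \<i> \<union> Stc1t R (- \<i>)))"
    (is "Digraph_Component.connected (tcg \<restriction> ?B)")
proof (rule connected_if_two_steps[of _ "tc_mat 1 (-1)"])
  show "?B \<subseteq> Stc R"
    using assms by (simp add: Stc1t_subset_Stc minus_closed)
  have h: "tc_mat 1 1 \<in> ?B" "tc_mat 1 (-1) \<in> ?B"
    by (simp_all add: tc_mat_in_Stc1t_iff)
  then show "tc_mat 1 (-1) \<in> ?B" by simp
  fix v assume "v \<in> ?B"
  then obtain c t where v: "c \<noteq> 0" "v = tc_mat c t" and "t \<in> {1, -1, \<i>, - \<i>}"
    by (auto simp: Stc1t_eq)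
  then consider "t\<^sup>2 = 1" | "t\<^sup>2 = - 1"
    by auto
  then show "tc_mat 1 (-1) ** v = 0 \<or> (\<exists>w\<in>?B. tc_mat 1 (-1) ** w = 0 \<and> w ** v = 0)"
  proof cases
    case 1
    then show ?thesis
      using v by (simp add: tc_mat_mult_eq_0_iff)
  next
    case 2
    then show ?thesis
      using v h by (intro disjI2 bexI[of _ "tc_mat 1 1"]) (simp_all add: tc_mat_mult_eq_0_iff)
  qed
qed

text \<open>Reduces the decomposition to parameters: \<open>P\<close> collects the parameter sets of
  the large components other than the bipartite one, and \<open>edge\<close> keeps each arc between
  cubic matrices inside one of these sets. Matrices with any other nonzero parameter are
  isolated.\<close>

lemma digraph_components_tcg:
  assumes sub: "\<And>T. T \<in> P \<Longrightarrow> T \<subseteq> R - {0}"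
    and disj: "\<And>T T'. T \<in> P \<Longrightarrow> T' \<in> P \<Longrightarrow> T \<noteq> T' \<Longrightarrow> T \<inter> T' = {}"
    and edge: "\<And>t s. t \<in> R \<Longrightarrow> s \<in> R \<Longrightarrow> t * s\<^sup>2 = - 1 \<Longrightarrow> \<exists>T\<in>P. t \<in> T \<and> s \<in> T"
    and conn: "\<And>T. T \<in> P \<Longrightarrow> Digraph_Component.connected (tcg \<restriction> (\<Union>t\<in>T. Stc1t R t))"
  shows "digraph_components tcg =
    insert (tcg \<restriction> (Stc1t R 0 \<union> Stc2 R)) ((\<lambda>T. tcg \<restriction> (\<Union>t\<in>T. Stc1t R t)) ` P) \<union>
    {tcg \<restriction> {v} | v. v \<in> (\<Union>t\<in>R - {0} - \<Union>P. Stc1t R t)}"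
proof -
  define I where "I = (\<Union>t\<in>R - {0} - \<Union>P. Stc1t R t)"
  define Q where "Q = insert (Stc1t R 0 \<union> Stc2 R) ((\<lambda>T. \<Union>t\<in>T. Stc1t R t) ` P) \<union> (\<lambda>v. {v}) ` I"
  have "digraph_components tcg = (\<lambda>B. tcg \<restriction> B) ` Q"
  proof (rule digraph_components_partition[OF wf_tcg])
    have "\<Union>Q = (\<Union>t\<in>{0} \<union> \<Union>P \<union> (R - {0} - \<Union>P). Stc1t R t) \<union> Stc2 R"
      by (simp add: Q_def I_def Un_ac UN_Un image_image del: Un_Diff_cancel Un_Diff_cancel2)
    also have "{0} \<union> \<Union>P \<union> (R - {0} - \<Union>P) = R"
      using sub numeral_closed(1) by blast
    finally show "\<Union>Q = verts tcg"
      by (simp add: Stc_def Stc1_def)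
    show "Digraph_Component.connected (tcg \<restriction> B)" if "B \<in> Q" for B
      using that conn connected_bipartite connected_singleton by (auto simp: Q_def)
    show "(tail tcg e \<in> B) = (head tcg e \<in> B)" if B: "B \<in> Q" and e_arc: "e \<in> arcs tcg" for B e
    proof -
      obtain v w where e: "e = (v, w)" "v \<in> Stc R" "w \<in> Stc R" "v ** w = 0"
        using e_arc by (auto simp: arcs_tcg)
      consider "B = Stc1t R 0 \<union> Stc2 R" | T where "T \<in> P" "B = (\<Union>t\<in>T. Stc1t R t)"
        | x where "x \<in> I" "B = {x}"
        using B by (auto simp: Q_def)
      note B_cases = this
      \<comment> \<open>The bipartite block is the only block that meets the bipartite vertex
        set.\<close>
      have B_bip: "x \<in> B \<longleftrightarrow> B = Stc1t R 0 \<union> Stc2 R" if x: "x \<in> Stc1t R 0 \<union> Stc2 R" for x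
      proof -
        have "x \<notin> Stc1t R t" if "t \<noteq> 0" for t
          using x that Stc1t_disjoint[of 0 t R] Stc1t_Stc2_disjoint[of R t] by blast
        then have notin: "x \<notin> (\<Union>t\<in>T. Stc1t R t)" if "0 \<notin> T" for T
          using that by (metis UN_E)
        have notin_I: "x \<notin> I"
          unfolding I_def by (rule notin) simp
        have notin_P: "x \<notin> (\<Union>t\<in>T. Stc1t R t)" if "T \<in> P" for T
          by (rule notin) (use sub[OF that] in blast)
        show ?thesis
          by (rule B_cases) (use x notin_I notin_P in blast)+
      qed
      have "v \<in> B \<longleftrightarrow> w \<in> B"
        using e(2)
      proof (cases rule: Stc_cases)
        case v: (1 c t)
        show ?thesis
          using e(3)
        proof (cases rule: Stc_cases)
          case w: (1 c' s)
          have ts: "t * s\<^sup>2 = - 1"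
            using e(4) v w by (simp add: tc_mat_mult_eq_0_iff)
          \<comment> \<open>Both ends lie in one \<open>T\<close>, which is disjoint from all other
            members of \<open>P\<close>; hence neither end is isolated or bipartite.\<close>
          then obtain T where T: "T \<in> P" "t \<in> T" "s \<in> T"
            using edge v w by blast
          have ne: "t \<noteq> 0" "s \<noteq> 0"
            using ts by auto
          show ?thesis
            using B_cases
          proof cases
            case 1
            then show ?thesis
              using ne v w by (simp add: tc_mat_in_Stc1t_iff tc_mat_notin_Stc2)
          next
            case (2 T')
            have "t \<in> T' \<longleftrightarrow> s \<in> T'"
              using disj[OF T(1) 2(1)] T by blast
            then show ?thesis
              using 2 v w by (simp add: tc_mat_in_Stc1t_iff)
          next
            case (3 x)
            then show ?thesis
              using T v w by (auto simp: I_def tc_mat_in_Stc1t_iff)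
          qed
        next
          case w: (2 c')
          then have "t = 0"
            using e(4) v by (simp add: tc_mat_mult_corner_mat_eq_0_iff)
          then show ?thesis
            using B_bip v w by (simp add: tc_mat_in_Stc1t_iff corner_mat_in_Stc2_iff)
        qed
      next
        case v: (2 c)
        show ?thesis
          using e(3)
        proof (cases rule: Stc_cases)
          case w: (1 c' s)
          then have "s = 0"
            using e(4) v by (simp add: tc_mat_mult_corner_mat_eq_0_iff)
          then show ?thesis
            using B_bip v w by (simp add: tc_mat_in_Stc1t_iff corner_mat_in_Stc2_iff)
        next
          case w: (2 c')
          then show ?thesis
            using e(4) v corner_mat_mult_neq_0 by blast
        qed
      qed
      then show ?thesis
        by (simp add: e)
    qed
  qed
  also have "\<dots> = insert (tcg \<restriction> (Stc1t R 0 \<union> Stc2 R)) ((\<lambda>T. tcg \<restriction> (\<Union>t\<in>T. Stc1t R t)) ` P) \<union>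
      {tcg \<restriction> {v} | v. v \<in> I}"
    by (auto simp: Q_def)
  finally show ?thesis
    unfolding I_def .
qed

end

section \<open>Decomposition in the three cases\<close>

theorem theorem3p2:
  fixes d :: nat and K R :: "complex set" and G :: "(complex^2^2, (complex^2^2) \<times> (complex^2^2)) pre_digraph"
  assumes d: "d = 0 \<or> (d > 0 \<and> squarefree d)"
    and K: "K = imag_quadratic_field d"
    and R: "R = ring_of_integers K"
    and G: "G = zero_divisor_graph (M2 R) \<restriction> Stc R"
  shows
    "(d \<noteq> 1 \<and> d \<noteq> 3 \<longrightarrow>
       (let G1 = G \<restriction> (Stc1t R 0 \<union> Stc2 R);
            G2 = G \<restriction> (Stc1t R (-1) \<union> Stc1t R 1);
            I = (\<Union>t \<in> R - {0, 1, -1}. Stc1t R t)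
        in digraph_components G = {G1, G2} \<union> {G \<restriction> {v} | v. v \<in> I} \<and>
           infinite (verts G1) \<and> complete_bipartite G1 \<and> girth G1 = 4 \<and>
           infinite (verts G2) \<and> \<not> symmetric G2 \<and> girth (mk_symmetric G2) = 3 \<and>
           (\<forall>v\<in>I. complete_digraph 1 (G \<restriction> {v})))) \<and>
     (d = 1 \<longrightarrow>
       (let G1 = G \<restriction> (Stc1t R 0 \<union> Stc2 R);
            G2 = G \<restriction> (Stc1t R (-1) \<union> Stc1t R 1 \<union> Stc1t R \<i> \<union> Stc1t R (-\<i>));
            I = (\<Union>t \<in> R - {0, 1, -1, \<i>, -\<i>}. Stc1t R t)
        in digraph_components G = {G1, G2} \<union> {G \<restriction> {v} | v. v \<in> I} \<and>
           infinite (verts G1) \<and> complete_bipartite G1 \<and> girth G1 = 4 \<and>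
           infinite (verts G2) \<and> \<not> symmetric G2 \<and> girth (mk_symmetric G2) = 3 \<and>
           (\<forall>v\<in>I. complete_digraph 1 (G \<restriction> {v})))) \<and>
     (d = 3 \<longrightarrow> (\<forall>\<omega>::complex. \<omega> ^ 3 = 1 \<and> \<omega> ^ 2 \<noteq> 1 \<and> \<omega> \<noteq> 1 \<longrightarrow>
       (let G1 = G \<restriction> (Stc1t R 0 \<union> Stc2 R);
            G2 = G \<restriction> (Stc1t R (-1) \<union> Stc1t R 1);
            G3 = G \<restriction> (Stc1t R \<omega> \<union> Stc1t R (-\<omega>));
            G4 = G \<restriction> (Stc1t R (\<omega>^2) \<union> Stc1t R (-(\<omega>^2)));
            I = (\<Union>t \<in> R - {0, 1, -1, \<omega>, -\<omega>, \<omega>^2, -(\<omega>^2)}. Stc1t R t)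
        in digraph_components G = {G1, G2, G3, G4} \<union> {G \<restriction> {v} | v. v \<in> I} \<and>
           infinite (verts G1) \<and> complete_bipartite G1 \<and> girth G1 = 4 \<and>
           infinite (verts G2) \<and> \<not> symmetric G2 \<and> girth (mk_symmetric G2) = 3 \<and>
           infinite (verts G3) \<and> \<not> symmetric G3 \<and> girth (mk_symmetric G3) = 3 \<and>
           infinite (verts G4) \<and> \<not> symmetric G4 \<and> girth (mk_symmetric G4) = 3 \<and>
           (\<forall>v\<in>I. complete_digraph 1 (G \<restriction> {v})))))"
proof -
  interpret tc_graph R
    using Ints_subset_ring_of_integers ring_of_integers_mult
    by unfold_locales (auto simp: R K)
  have G_eq: "G = tcg"
    by (simp add: G tcg_def)
  have unit: "s = 1 \<or> s = - 1 \<or> (d = 1 \<and> s\<^sup>2 = - 1) \<or>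
      (d = 3 \<and> (s\<^sup>2 + s + 1 = 0 \<or> s\<^sup>2 - s + 1 = 0))"
    if "t \<in> R" "s \<in> R" "t * s\<^sup>2 = - 1" for t s
    using ring_of_integers_neg_square_unit[of d s t] d that by (auto simp: R K)
  have singletons: "\<forall>v\<in>(\<Union>t\<in>R - S. Stc1t R t). complete_digraph 1 (tcg \<restriction> {v})" for S
    using complete_digraph_singleton Stc1t_subset_Stc by blast
  have infinite_bipartite: "infinite (verts (tcg \<restriction> (Stc1t R 0 \<union> Stc2 R)))"
    using infinite_Stc1t by simp
  have pair: "infinite (verts (tcg \<restriction> (Stc1t R (- u) \<union> Stc1t R u)))"
    "\<not> symmetric (tcg \<restriction> (Stc1t R (- u) \<union> Stc1t R u))"
    "girth (mk_symmetric (tcg \<restriction> (Stc1t R (- u) \<union> Stc1t R u))) = 3"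
    if u: "u \<in> R" "u ^ 3 = 1" for u
  proof -
    have "Stc1t R (- u) \<union> Stc1t R u \<subseteq> Stc R"
      using u by (simp add: Stc1t_subset_Stc minus_closed)
    note infinite_tcg[OF u order_refl this] not_symmetric_tcg[OF u order_refl this]
      girth_mk_symmetric_tcg[OF u order_refl this]
    then show "infinite (verts (tcg \<restriction> (Stc1t R (- u) \<union> Stc1t R u)))"
      "\<not> symmetric (tcg \<restriction> (Stc1t R (- u) \<union> Stc1t R u))"
      "girth (mk_symmetric (tcg \<restriction> (Stc1t R (- u) \<union> Stc1t R u))) = 3"
      by blast+
  qed
  \<comment> \<open>The components of \<open>\<omega>\<close> and \<open>\<omega>\<^sup>2\<close>
    list the positive parameter first.\<close>
  note pair' = pair[unfolded Un_commute[of "Stc1t R (- _)"]]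
  have case1: "digraph_components tcg =
      {tcg \<restriction> (Stc1t R 0 \<union> Stc2 R), tcg \<restriction> (Stc1t R (-1) \<union> Stc1t R 1)} \<union>
      {tcg \<restriction> {v} | v. v \<in> (\<Union>t \<in> R - {0, 1, -1}. Stc1t R t)}" if "d \<noteq> 1" "d \<noteq> 3"
  proof -
    have "digraph_components tcg =
        insert (tcg \<restriction> (Stc1t R 0 \<union> Stc2 R)) ((\<lambda>T. tcg \<restriction> (\<Union>t\<in>T. Stc1t R t)) ` {{-1, 1}}) \<union>
        {tcg \<restriction> {v} | v. v \<in> (\<Union>t\<in>R - {0} - \<Union>{{-1, 1}}. Stc1t R t)}"
    proof (rule digraph_components_tcg)
      show "\<exists>T\<in>{{-1, 1}}. t \<in> T \<and> s \<in> T" if "t \<in> R" "s \<in> R" "t * s\<^sup>2 = - 1" for t s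
        using unit[OF that] that(3) \<open>d \<noteq> 1\<close> \<open>d \<noteq> 3\<close> by auto
      show "Digraph_Component.connected (tcg \<restriction> (\<Union>t\<in>T. Stc1t R t))" if "T \<in> {{-1, 1}}" for T
        using connected_cube_root_pair[of 1] that by simp
    qed auto
    moreover have "R - {0} - \<Union>{{-1, 1}} = R - {0, 1, -1}"
      by auto
    ultimately show ?thesis
      by simp
  qed
  have case2: "digraph_components tcg =
      {tcg \<restriction> (Stc1t R 0 \<union> Stc2 R),
       tcg \<restriction> (Stc1t R (-1) \<union> Stc1t R 1 \<union> Stc1t R \<i> \<union> Stc1t R (-\<i>))} \<union>
      {tcg \<restriction> {v} | v. v \<in> (\<Union>t \<in> R - {0, 1, -1, \<i>, -\<i>}. Stc1t R t)}" if "d = 1"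
  proof -
    have i: "\<i> \<in> R" "- \<i> \<in> R"
      using imaginary_unit_in_ring_of_integers minus_closed that by (auto simp: R K)
    have "digraph_components tcg =
        insert (tcg \<restriction> (Stc1t R 0 \<union> Stc2 R)) ((\<lambda>T. tcg \<restriction> (\<Union>t\<in>T. Stc1t R t)) ` {{-1, 1, \<i>, -\<i>}}) \<union>
        {tcg \<restriction> {v} | v. v \<in> (\<Union>t\<in>R - {0} - \<Union>{{-1, 1, \<i>, -\<i>}}. Stc1t R t)}"
    proof (rule digraph_components_tcg)
      \<comment> \<open>A square 1 of \<open>s\<close> gives \<open>t = - 1\<close>, a square -1
        gives \<open>t = 1\<close>; this second kind of arc merges the four families.\<close>
      show "\<exists>T\<in>{{-1, 1, \<i>, -\<i>}}. t \<in> T \<and> s \<in> T" if ts: "t \<in> R" "s \<in> R" "t * s\<^sup>2 = - 1" for t s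
      proof -
        have "s = \<i> \<or> s = - \<i>" if "s\<^sup>2 = - 1"
          using that power2_eq_iff[of s \<i>] by simp
        then show ?thesis
          using unit[OF ts] ts(3) \<open>d = 1\<close> by auto
      qed
      show "Digraph_Component.connected (tcg \<restriction> (\<Union>t\<in>T. Stc1t R t))" if "T \<in> {{-1, 1, \<i>, -\<i>}}" for T
        using connected_fourth_roots[OF i(1)] that by (simp add: Un_assoc)
    qed (use i in auto)
    moreover have "R - {0} - \<Union>{{-1, 1, \<i>, -\<i>}} = R - {0, 1, -1, \<i>, -\<i>}"
      by auto
    ultimately show ?thesis
      by (simp add: Un_assoc)
  qed
  have case3: "digraph_components tcg =
      {tcg \<restriction> (Stc1t R 0 \<union> Stc2 R), tcg \<restriction> (Stc1t R (-1) \<union> Stc1t R 1),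
       tcg \<restriction> (Stc1t R \<omega> \<union> Stc1t R (-\<omega>)), tcg \<restriction> (Stc1t R (\<omega>^2) \<union> Stc1t R (-(\<omega>^2)))} \<union>
      {tcg \<restriction> {v} | v. v \<in> (\<Union>t \<in> R - {0, 1, -1, \<omega>, -\<omega>, \<omega>^2, -(\<omega>^2)}. Stc1t R t)}"
    if "d = 3" and \<omega>: "\<omega>\<^sup>2 + \<omega> + 1 = 0" and \<omega>_R: "\<omega> \<in> R" for \<omega>
  proof -
    let ?P = "{{-1, 1}, {\<omega>, -\<omega>}, {\<omega>\<^sup>2, -(\<omega>\<^sup>2)}}"
    have "\<omega>\<^sup>2 = (\<omega>\<^sup>2 + \<omega> + 1) - \<omega> - 1"
      by simp
    then have w2: "\<omega>\<^sup>2 = - \<omega> - 1"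
      by (simp add: \<omega>)
    have "\<omega> * \<omega>\<^sup>2 = (\<omega> - 1) * (\<omega>\<^sup>2 + \<omega> + 1) + 1"
      by (simp add: algebra_simps power2_eq_square)
    then have w3: "\<omega> * \<omega>\<^sup>2 = 1"
      by (simp add: \<omega>)
    have "(\<omega>\<^sup>2)\<^sup>2 * \<omega>\<^sup>2 = (\<omega> * \<omega>\<^sup>2)\<^sup>2"
      by (simp add: power2_eq_square)
    then have w6: "(\<omega>\<^sup>2)\<^sup>2 * \<omega>\<^sup>2 = 1"
      by (simp add: w3)
    have mem: "\<omega> \<in> R" "- \<omega> \<in> R" "\<omega>\<^sup>2 \<in> R" "- (\<omega>\<^sup>2) \<in> R"
      using \<omega>_R by (auto intro: minus_closed power_closed)
    have ne: "\<omega> \<noteq> 0" "\<omega> \<noteq> 1" "\<omega> \<noteq> - 1"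
      using \<omega> by auto
    have "\<omega>\<^sup>2 \<noteq> 1" "\<omega>\<^sup>2 \<noteq> \<omega>"
      using ne by (auto simp: power2_eq_1_iff) (simp add: power2_eq_square)
    moreover have "\<omega>\<^sup>2 \<noteq> - 1" "\<omega>\<^sup>2 \<noteq> - \<omega>"
      using ne by (auto simp: w2)
    ultimately have disjoint: "{-1, 1} \<inter> {\<omega>, -\<omega>} = {}" "{-1, 1} \<inter> {\<omega>\<^sup>2, -(\<omega>\<^sup>2)} = {}"
      "{\<omega>, -\<omega>} \<inter> {\<omega>\<^sup>2, -(\<omega>\<^sup>2)} = {}"
      using ne by (auto simp: minus_equation_iff[of _ 1] equation_minus_iff)
    have "digraph_components tcg =
        insert (tcg \<restriction> (Stc1t R 0 \<union> Stc2 R)) ((\<lambda>T. tcg \<restriction> (\<Union>t\<in>T. Stc1t R t)) ` ?P) \<union>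
        {tcg \<restriction> {v} | v. v \<in> (\<Union>t\<in>R - {0} - \<Union>?P. Stc1t R t)}"
    proof (rule digraph_components_tcg)
      show "T \<subseteq> R - {0}" if "T \<in> ?P" for T
        using that mem ne by auto
      show "T \<inter> T' = {}" if "T \<in> ?P" "T' \<in> ?P" "T \<noteq> T'" for T T'
        using that disjoint by (elim insertE emptyE) (metis Int_commute)+
      show "\<exists>T\<in>?P. t \<in> T \<and> s \<in> T" if ts: "t \<in> R" "s \<in> R" "t * s\<^sup>2 = - 1" for t s
      proof -
        \<comment> \<open>The quadratic factors with roots \<open>\<omega>\<close> and
          \<open>\<omega>\<^sup>2\<close>; it is applied to \<open>s\<close> and to
          \<open>- s\<close>.\<close>
        have root: "x = \<omega> \<or> x = \<omega>\<^sup>2" if "x\<^sup>2 + x + 1 = 0" for x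
        proof -
          have "(x - \<omega>) * (x - \<omega>\<^sup>2) = (x\<^sup>2 + x + 1) - (\<omega>\<^sup>2 + \<omega> + 1) * x + (\<omega> * \<omega>\<^sup>2 - 1)"
            by (simp add: algebra_simps power2_eq_square)
          then have "(x - \<omega>) * (x - \<omega>\<^sup>2) = 0"
            by (simp only: that \<omega> w3) simp
          then show ?thesis by simp
        qed
        consider "s\<^sup>2 = 1" "s = 1 \<or> s = -1" | "s\<^sup>2 = \<omega>\<^sup>2" "s = \<omega> \<or> s = -\<omega>"
          | "s\<^sup>2 = (\<omega>\<^sup>2)\<^sup>2" "s = \<omega>\<^sup>2 \<or> s = -(\<omega>\<^sup>2)"
          using unit[OF ts] root[of s] root[of "-s"] \<open>d = 3\<close>
          by (auto simp: minus_equation_iff[of s])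
        then show ?thesis
        proof cases
          case 1
          then show ?thesis using ts(3) by auto
        next
          case 2
          \<comment> \<open>Multiplying \<open>t * \<omega>\<^sup>2 = - 1\<close> by
            \<open>\<omega>\<close> isolates \<open>t\<close>; the arc stays within one pair of
            opposite parameters.\<close>
          have "t = - \<omega>"
            using ts(3) w3 unfolding 2(1) by (metis mult.assoc mult.commute mult_1 mult_minus1)
          then show ?thesis using 2 by auto
        next
          case 3
          have "t = - (\<omega>\<^sup>2)"
            using ts(3) w6 unfolding 3(1) by (metis mult.assoc mult_1_right mult_minus1)
          then show ?thesis using 3 by auto
        qed
      qed
      show "Digraph_Component.connected (tcg \<restriction> (\<Union>t\<in>T. Stc1t R t))" if "T \<in> ?P" for T
      proof -
        have "\<omega> ^ 3 = 1" "(\<omega>\<^sup>2) ^ 3 = 1"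
          using w3 w6 by (simp_all add: power2_eq_square power3_eq_cube mult.assoc)
        then show ?thesis
          using that connected_cube_root_pair[of 1] connected_cube_root_pair[of \<omega>]
            connected_cube_root_pair[of "\<omega>\<^sup>2"] mem by (auto simp: Un_commute)
      qed
    qed
    moreover have "R - {0} - \<Union>?P = R - {0, 1, -1, \<omega>, -\<omega>, \<omega>\<^sup>2, -(\<omega>\<^sup>2)}"
      by auto
    ultimately show ?thesis
      by simp
  qed
  note bipartite = infinite_bipartite complete_bipartite_tcg girth_bipartite
  show ?thesis
    unfolding Let_def G_eq
  proof (intro conjI[OF impI conjI[OF impI impI[OF allI[OF impI]]]], goal_cases)
    case 1
    then show ?case
      by (intro conjI case1 bipartite pair[of 1] singletons) auto
  next
    case 2
    then have i: "\<i> \<in> R" "- \<i> \<in> R"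
      using imaginary_unit_in_ring_of_integers minus_closed by (auto simp: R K)
    let ?B = "Stc1t R (-1) \<union> Stc1t R 1 \<union> Stc1t R \<i> \<union> Stc1t R (-\<i>)"
    have B: "Stc1t R (- 1) \<union> Stc1t R 1 \<subseteq> ?B" "?B \<subseteq> Stc R"
      using i by (blast, simp add: Stc1t_subset_Stc)
    show ?case
      \<comment> \<open>Asymmetry and the triangle are already found in the families of 1 and -1,
        that is, with \<open>u = 1\<close>.\<close>
      using 2 by (intro conjI case2 bipartite singletons
          infinite_tcg[OF _ _ B] not_symmetric_tcg[OF _ _ B] girth_mk_symmetric_tcg[OF _ _ B]) auto
  next
    case (3 \<omega>)
    \<comment> \<open>As \<open>\<omega>\<close> differs from 1, the first factor cancels.\<close>
    have "(\<omega> - 1) * (\<omega>\<^sup>2 + \<omega> + 1) = \<omega> ^ 3 - 1"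
      by (simp add: algebra_simps power2_eq_square power3_eq_cube)
    then have \<omega>: "\<omega>\<^sup>2 + \<omega> + 1 = 0"
      using 3 by simp
    then have R: "\<omega> \<in> R"
      using cube_root_of_unity_in_ring_of_integers 3 by (simp add: R K)
    have "(\<omega>\<^sup>2) ^ 3 = (\<omega> ^ 3)\<^sup>2"
      by (simp flip: power_mult)
    then have "(\<omega>\<^sup>2) ^ 3 = 1"
      using 3 by simp
    then show ?case
      using 3 R \<omega> power_closed[OF R, of 2]
      by (intro conjI case3 bipartite pair[of 1] pair' singletons) auto
  qed
qed

end
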